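(* Let $A$ be a nonzero compact operator on a complex Hilbert space $H$. Then $A$ is normal if and only if $\sigma_p(A,A^* )$ is the union of countably many, locally finite, complex lines in $\mathbb C^2$.
   Context: For a pair $(A_1,A_2)$ of bounded linear operators on $H$, the joint point spectrum is $$\sigma_p(A_1,A_2)=\{(z_1,z_2)\in\mathbb C^2:\ker(I+z_1A_1+z_2A_2)\neq(0)\}.$$ A complex line in $\mathbb C^2$ is an affine complex subspace of dimension one. "Countably many" includes finitely many. A family of lines is locally finite if every point of $\mathbb C^2$ has a neighborhood meeting only finitely many members of the family. *)

theory Defs
  imports "HOL-Analysis.Analysis"
begin

class complex_vector = real_vector +
  fixes scaleC :: "complex \<Rightarrow> 'a \<Rightarrow> 'a"  (infixr \<open>*\<^sub>C\<close> 75)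
  assumes scaleC_add_right: "c *\<^sub>C (x + y) = c *\<^sub>C x + c *\<^sub>C y"
    and scaleC_add_left: "(c + d) *\<^sub>C x = c *\<^sub>C x + d *\<^sub>C x"
    and scaleC_scaleC: "c *\<^sub>C d *\<^sub>C x = (c * d) *\<^sub>C x"
    and scaleC_of_real: "complex_of_real r *\<^sub>C x = r *\<^sub>R x"

(* Linear in the first argument; the last axiom contains positive definiteness. *)
class complex_inner = complex_vector + real_normed_vector +
  fixes cinner :: "'a \<Rightarrow> 'a \<Rightarrow> complex"
  assumes cinner_add_left: "cinner (x + y) z = cinner x z + cinner y z"
    and cinner_scaleC_left: "cinner (c *\<^sub>C x) y = c * cinner x y"
    and cinner_commute: "cinner y x = cnj (cinner x y)"
    and cinner_self: "cinner x x = complex_of_real ((norm x)\<^sup>2)"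

class chilbert_space = complex_inner + complete_space

instantiation complex :: chilbert_space
begin

definition scaleC_complex :: "complex \<Rightarrow> complex \<Rightarrow> complex"
  where "scaleC_complex c x = c * x"

definition cinner_complex :: "complex \<Rightarrow> complex \<Rightarrow> complex"
  where "cinner_complex x y = x * cnj y"

instance
proof
  show "cinner x x = complex_of_real ((norm x)\<^sup>2)" for x :: complex
    unfolding cinner_complex_def by (simp only: complex_norm_square)
qed (simp_all add: scaleC_complex_def cinner_complex_def algebra_simps scaleR_conv_of_real)

end

definition bounded_clinear :: "('a::complex_inner \<Rightarrow> 'b::complex_inner) \<Rightarrow> bool"
  where "bounded_clinear A \<longleftrightarrow> bounded_linear A \<and> (\<forall>c x. A (c *\<^sub>C x) = c *\<^sub>C A x)"

definition compact_operator :: "('a::complex_inner \<Rightarrow> 'b::complex_inner) \<Rightarrow> bool"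
  where "compact_operator A \<longleftrightarrow>
    bounded_clinear A \<and> (\<forall>S. bounded S \<longrightarrow> compact (closure (A ` S)))"

(* Meaningful for bounded operators on a Hilbert space, which have exactly one adjoint. *)
definition cadjoint :: "('a::chilbert_space \<Rightarrow> 'a) \<Rightarrow> 'a \<Rightarrow> 'a"
  where "cadjoint A = (THE B. \<forall>x y. cinner (A x) y = cinner x (B y))"

definition normal_operator :: "('a::chilbert_space \<Rightarrow> 'a) \<Rightarrow> bool"
  where "normal_operator A \<longleftrightarrow> A \<circ> cadjoint A = cadjoint A \<circ> A"

definition joint_point_spectrum ::
    "('a::chilbert_space \<Rightarrow> 'a) \<Rightarrow> ('a \<Rightarrow> 'a) \<Rightarrow> (complex ^ 2) set"
  where "joint_point_spectrum A\<^sub>1 A\<^sub>2 =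
    {z. {x. x + z $ 1 *\<^sub>C A\<^sub>1 x + z $ 2 *\<^sub>C A\<^sub>2 x = 0} \<noteq> {0}}"

(* vec.subspace and vec.dim are the notions over the scalar field complex; the unqualified
   subspace, dim, affine and aff_dim would be over the reals. *)
definition complex_line :: "(complex ^ 2) set \<Rightarrow> bool"
  where "complex_line L \<longleftrightarrow>
    (\<exists>p V. vec.subspace V \<and> vec.dim V = 1 \<and> L = (\<lambda>v. p + v) ` V)"

end

theory Submission
  imports Defs
begin

text \<open>A common eigenvector of \<open>A\<close> and \<open>A\<^sup>*\<close>, with eigenvalues \<open>l\<close> and \<open>cnj l\<close>, contributes to the joint
  point spectrum the line \<open>1 + l z\<^sub>1 + cnj l z\<^sub>2 = 0\<close>. Both directions amount to finding enough such vectors.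

  If \<open>A\<close> is normal, the kernel of \<open>I + z\<^sub>1 A + z\<^sub>2 A\<^sup>*\<close> is invariant under \<open>A\<close> and \<open>A\<^sup>*\<close>. The real and
  imaginary parts of \<open>A\<close> are commuting compact self-adjoint operators on it and have a common eigenvector, so
  every point of the spectrum lies on one of the lines above (\<open>joint_point_spectrum_normal\<close>). Compactness
  makes the eigenvalues accumulate only at \<open>0\<close>, which sends the lines to infinity
  (\<open>finite_large_joint_eigenvalues\<close>, \<open>locally_finite_dual_lines\<close>).

  Conversely, suppose that the spectrum is a locally finite union of lines, and let \<open>N\<close> be the orthogonal
  complement of all joint eigenvectors. If \<open>A\<close> did not vanish on \<open>N\<close>, one could rotate \<open>A\<close> so that its
  numerical radius \<open>r\<close> on \<open>N\<close> is approached in the direction of the positive real axis. For \<open>H = A + A\<^sup>*\<close> and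
  \<open>K = \<i> (A - A\<^sup>*)\<close>, the largest eigenvalue of \<open>H + t K\<close> on \<open>N\<close> lies between \<open>2 r\<close> and
  \<open>2 r sqrt (1 + t\<^sup>2)\<close>; but the lines force it to be one of finitely many affine functions of \<open>t\<close>, so near
  \<open>t = 0\<close> it is constantly \<open>2 r\<close>. A top eigenvector of \<open>H\<close> is then annihilated by \<open>K\<close>, that is, it is a
  joint eigenvector inside \<open>N\<close>, a contradiction (\<open>joint_eigenvector_if_spectrum_in_lines\<close>). Hence \<open>A\<close>
  vanishes on \<open>N\<close>, and this makes the commutator of \<open>A\<close> and \<open>A\<^sup>*\<close> vanish everywhere
  (\<open>normal_if_zero_on_complement\<close>).\<close>

section \<open>Complex inner product spaces\<close>

lemma scaleC_zero_left [simp]: "0 *\<^sub>C x = (0::'a::complex_vector)"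
  using scaleC_of_real[of 0 x] by simp

lemma scaleC_one [simp]: "1 *\<^sub>C x = (x::'a::complex_vector)"
  using scaleC_of_real[of 1 x] by simp

lemma scaleC_zero_right [simp]: "c *\<^sub>C (0::'a::complex_vector) = 0"
  using scaleC_add_right[of c "0::'a" 0] by simp

lemma scaleC_minus_right: "c *\<^sub>C (- x) = - (c *\<^sub>C (x::'a::complex_vector))"
  using scaleC_add_right[of c x "- x"] by (simp add: eq_neg_iff_add_eq_0 add.commute)

lemma scaleC_minus_left: "(- c) *\<^sub>C x = - (c *\<^sub>C (x::'a::complex_vector))"
  using scaleC_add_left[of c "- c" x] by (simp add: eq_neg_iff_add_eq_0 add.commute)

lemma scaleC_diff_right: "c *\<^sub>C (x - y) = c *\<^sub>C x - c *\<^sub>C (y::'a::complex_vector)"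
  using scaleC_add_right[of c x "- y"] by (simp add: scaleC_minus_right)

lemma scaleC_diff_left: "(c - d) *\<^sub>C x = c *\<^sub>C x - d *\<^sub>C (x::'a::complex_vector)"
  using scaleC_add_left[of c "- d" x] by (simp add: scaleC_minus_left)

lemmas scaleC_simps = scaleC_add_right scaleC_add_left scaleC_diff_right scaleC_diff_left
  scaleC_minus_right scaleC_minus_left scaleC_scaleC

lemma scaleC_eq_0_iff [simp]: "c *\<^sub>C x = 0 \<longleftrightarrow> c = 0 \<or> x = (0::'a::complex_vector)"
proof -
  have "x = 0" if "c *\<^sub>C x = 0" "c \<noteq> 0"
    using that scaleC_scaleC[of "inverse c" c x] by simp
  then show ?thesis by auto
qed

context
  fixes x y z :: "'a::complex_inner"
begin

lemma cinner_add_right: "cinner x (y + z) = cinner x y + cinner x z"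
  by (metis cinner_add_left cinner_commute complex_cnj_add)

lemma cinner_scaleC_right: "cinner x (c *\<^sub>C y) = cnj c * cinner x y"
  by (metis cinner_scaleC_left cinner_commute complex_cnj_mult)

lemma cinner_zero_left [simp]: "cinner 0 x = 0"
  using cinner_scaleC_left[of 0 x x] by simp

lemma cinner_zero_right [simp]: "cinner x 0 = 0"
  using cinner_commute[of x 0] by (simp add: cinner_zero_left)

end

lemma cinner_scaleR_left: "cinner (r *\<^sub>R x) y = of_real r * cinner x (y::'a::complex_inner)"
  using cinner_scaleC_left[of "of_real r" x y] by (simp add: scaleC_of_real)

lemma cinner_scaleR_right: "cinner x (r *\<^sub>R y) = of_real r * cinner x (y::'a::complex_inner)"
  using cinner_scaleC_right[of x "of_real r" y] by (simp add: scaleC_of_real)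

lemma cinner_minus_left: "cinner (- x) y = - cinner x (y::'a::complex_inner)"
  using cinner_scaleR_left[of "-1" x y] by simp

lemma cinner_minus_right: "cinner x (- y) = - cinner x (y::'a::complex_inner)"
  using cinner_scaleR_right[of x "-1" y] by simp

lemma cinner_diff_left: "cinner (x - y) z = cinner x z - cinner y (z::'a::complex_inner)"
  using cinner_add_left[of x "- y" z] by (simp add: cinner_minus_left)

lemma cinner_diff_right: "cinner x (y - z) = cinner x y - cinner x (z::'a::complex_inner)"
  using cinner_add_right[of x y "- z"] by (simp add: cinner_minus_right)

lemmas cinner_simps = cinner_add_left cinner_add_right cinner_diff_left cinner_diff_right
  cinner_minus_left cinner_minus_right cinner_scaleC_left cinner_scaleC_right
  cinner_scaleR_left cinner_scaleR_right

lemma norm_sq_eq_Re_cinner: "(norm x)\<^sup>2 = Re (cinner x (x::'a::complex_inner))"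
  by (simp add: cinner_self)

lemma Re_cinner_commute: "Re (cinner y x) = Re (cinner x (y::'a::complex_inner))"
  by (metis cinner_commute complex_cnj(1) complex.sel(1) cnj.simps(1))

lemma cinner_self_eq_0_iff: "cinner x x = 0 \<longleftrightarrow> x = (0::'a::complex_inner)"
  by (simp add: cinner_self)

lemma cinner_ext:
  fixes y z :: "'a::complex_inner"
  assumes "\<And>x. cinner x y = cinner x z"
  shows "y = z"
proof -
  have "cinner (y - z) (y - z) = 0" using assms by (simp add: cinner_diff_right)
  then show ?thesis by (simp add: cinner_self_eq_0_iff)
qed

lemma norm_scaleC: "norm (c *\<^sub>C x) = cmod c * norm (x::'a::complex_inner)"
proof -
  have "complex_of_real ((norm (c *\<^sub>C x))\<^sup>2) = c * cnj c * complex_of_real ((norm x)\<^sup>2)"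
    by (simp only: cinner_self[symmetric] cinner_simps mult.assoc mult.left_commute)
  also have "\<dots> = complex_of_real ((cmod c * norm x)\<^sup>2)"
    by (simp add: complex_norm_square[symmetric] power_mult_distrib)
  finally have "(norm (c *\<^sub>C x))\<^sup>2 = (cmod c * norm x)\<^sup>2"
    by (simp only: of_real_eq_iff)
  then show ?thesis by (simp add: power2_eq_iff_nonneg)
qed

lemma norm_add_sq:
  "(norm (x + y))\<^sup>2 = (norm x)\<^sup>2 + 2 * Re (cinner x y) + (norm (y::'a::complex_inner))\<^sup>2"
  unfolding norm_sq_eq_Re_cinner using Re_cinner_commute[of x y] by (simp add: cinner_simps)

lemma norm_diff_sq:
  "(norm (x - y))\<^sup>2 = (norm x)\<^sup>2 - 2 * Re (cinner x y) + (norm (y::'a::complex_inner))\<^sup>2"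
  unfolding norm_sq_eq_Re_cinner using Re_cinner_commute[of x y] by (simp add: cinner_simps)

lemma cinner_Cauchy_Schwarz: "cmod (cinner x y) \<le> norm x * norm (y::'a::complex_inner)"
proof (cases "y = 0")
  case False
  define p where "p = cinner x y"
  define n where "n = (norm y)\<^sup>2"
  have n: "n > 0" using False by (simp add: n_def)
  have "0 \<le> (norm (n *\<^sub>R x - p *\<^sub>C y))\<^sup>2" by simp
  also have "\<dots> = n\<^sup>2 * (norm x)\<^sup>2 - 2 * n * (cmod p)\<^sup>2 + (cmod p)\<^sup>2 * n"
  proof -
    have "cinner (n *\<^sub>R x) (p *\<^sub>C y) = of_real n * (p * cnj p)"
      by (simp add: cinner_simps p_def)
    then have "Re (cinner (n *\<^sub>R x) (p *\<^sub>C y)) = n * (cmod p)\<^sup>2"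
      by (simp only: complex_norm_square[symmetric] of_real_mult[symmetric] Re_complex_of_real)
    then show ?thesis
      unfolding norm_diff_sq by (simp add: norm_scaleC power_mult_distrib n_def)
  qed
  finally have "0 \<le> n * (n * (norm x)\<^sup>2 - (cmod p)\<^sup>2)"
    by (simp add: algebra_simps power2_eq_square)
  then have "(cmod p)\<^sup>2 \<le> (norm x * norm y)\<^sup>2"
    using n by (simp add: zero_le_mult_iff n_def power_mult_distrib mult.commute)
  then show ?thesis unfolding p_def by (rule power2_le_imp_le) simp
qed simp

lemma bounded_bilinear_cinner: "bounded_bilinear (cinner :: 'a::complex_inner \<Rightarrow> 'a \<Rightarrow> complex)"
proof
  show "\<exists>K. \<forall>a b :: 'a. cmod (cinner a b) \<le> norm a * norm b * K"
    by (rule exI[of _ 1]) (simp add: cinner_Cauchy_Schwarz)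
qed (simp_all add: cinner_simps scaleR_conv_of_real)

lemma bounded_linear_scaleC: "bounded_linear (\<lambda>x::'a::complex_inner. c *\<^sub>C x)"
proof
  show "\<exists>K. \<forall>x::'a. norm (c *\<^sub>C x) \<le> norm x * K"
    by (rule exI[of _ "cmod c"]) (simp add: norm_scaleC mult.commute)
  show "c *\<^sub>C (r *\<^sub>R x) = r *\<^sub>R (c *\<^sub>C x)" for r and x :: 'a
    by (simp add: scaleC_of_real[symmetric] scaleC_scaleC mult.commute)
qed (simp add: scaleC_add_right)

section \<open>The adjoint\<close>

lemma linear_term_zero_of_quadratic_nonneg:
  fixes a b :: real
  assumes "\<And>s. 0 \<le> s\<^sup>2 * a + 2 * s * b"
  shows "b = 0"
proof (rule ccontr)
  assume "b \<noteq> 0"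
  define k where "k = \<bar>a\<bar> + 1"
  have k: "k > 0" "a < k" by (auto simp: k_def)
  have "0 \<le> (- b / k)\<^sup>2 * a + 2 * (- b / k) * b" by (rule assms)
  also have "\<dots> \<le> (- b / k)\<^sup>2 * k + 2 * (- b / k) * b"
    using k by (intro add_right_mono mult_left_mono) auto
  also have "\<dots> = - b\<^sup>2 / k" using k by (simp add: field_simps power2_eq_square)
  also have "\<dots> < 0" using k \<open>b \<noteq> 0\<close> by simp
  finally show False by simp
qed

text \<open>The representing vector minimizes \<open>J x = \<parallel>x\<parallel>\<^sup>2 - 2 Re (f x)\<close>. The parallelogram law makes every
  minimizing sequence Cauchy, and the vanishing first variation at the limit is the claim.\<close>

theorem Riesz_representation:
  fixes f :: "'a::chilbert_space \<Rightarrow> complex"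
  assumes "bounded_linear f" and hom: "\<And>c x. f (c *\<^sub>C x) = c * f x"
  shows "\<exists>y. \<forall>x. f x = cinner x y"
proof -
  interpret bounded_linear f by fact
  define J where "J x = (norm x)\<^sup>2 - 2 * Re (f x)" for x
  obtain K where K: "\<And>x. cmod (f x) \<le> norm x * K" using bounded by blast
  have "- K\<^sup>2 \<le> J x" for x
  proof -
    have "Re (f x) \<le> norm x * K" using K[of x] complex_Re_le_cmod[of "f x"] by linarith
    moreover have "0 \<le> (norm x - K)\<^sup>2" by simp
    ultimately show ?thesis by (simp add: J_def power2_eq_square algebra_simps)
  qed
  then have bdd: "bdd_below (range J)" by (intro bdd_belowI2)
  define m where "m = Inf (range J)"
  have mJ: "m \<le> J x" for x unfolding m_def using bdd by (simp add: cInf_lower)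
  have "\<exists>x. J x < m + inverse (real (Suc n))" for n
    using cInf_lessD[of "range J" "m + inverse (real (Suc n))"] by (auto simp: m_def)
  then obtain X where X: "\<And>n. J (X n) < m + inverse (real (Suc n))" by metis
  have par: "(norm (x - y))\<^sup>2 / 2 \<le> J x + J y - 2 * m" for x y
  proof -
    have "(norm ((1/2) *\<^sub>R (x + y)))\<^sup>2 = (norm (x + y))\<^sup>2 / 4"
      by (simp add: power_divide)
    then have "2 * J ((1/2) *\<^sub>R (x + y)) + (norm (x - y))\<^sup>2 / 2 = J x + J y"
      unfolding J_def by (simp add: scaleR add norm_add_sq norm_diff_sq field_simps)
    then show ?thesis using mJ[of "(1/2) *\<^sub>R (x + y)"] by linarith
  qed
  have "Cauchy X"
  proof (rule metric_CauchyI)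
    fix e :: real assume "e > 0"
    then obtain M where M: "inverse (real (Suc M)) < e\<^sup>2 / 4"
      using reals_Archimedean[of "e\<^sup>2 / 4"] by auto
    have "dist (X i) (X j) < e" if "i \<ge> M" "j \<ge> M" for i j
    proof -
      have "inverse (real (Suc i)) \<le> inverse (real (Suc M))"
        "inverse (real (Suc j)) \<le> inverse (real (Suc M))"
        using that by (auto intro!: le_imp_inverse_le)
      then have "(norm (X i - X j))\<^sup>2 < e\<^sup>2"
        using par[of "X i" "X j"] X[of i] X[of j] M by linarith
      then show ?thesis using \<open>e > 0\<close> by (simp add: dist_norm power_less_imp_less_base)
    qed
    then show "\<exists>M. \<forall>i\<ge>M. \<forall>j\<ge>M. dist (X i) (X j) < e" by blast
  qed
  then obtain y where y: "X \<longlonglongrightarrow> y" using Cauchy_convergent_iff convergent_def by blast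
  have "(\<lambda>n. J (X n)) \<longlonglongrightarrow> J y"
    unfolding J_def by (intro tendsto_intros y tendsto)
  moreover have "(\<lambda>n. m + inverse (real (Suc n))) \<longlonglongrightarrow> m"
    using tendsto_add[OF tendsto_const[of m] LIMSEQ_inverse_real_of_nat] by simp
  ultimately have "J y \<le> m"
    using X by (intro LIMSEQ_le[of "\<lambda>n. J (X n)"]) (auto intro: less_imp_le)
  have real_part: "Re (f x) = Re (cinner x y)" for x
  proof -
    have "0 \<le> s\<^sup>2 * (norm x)\<^sup>2 + 2 * s * (Re (cinner x y) - Re (f x))" for s
    proof -
      have "J y \<le> J (y + s *\<^sub>R x)" using mJ \<open>J y \<le> m\<close> order_trans by blast
      then show ?thesis
        unfolding J_def norm_add_sq
        by (simp add: add scaleR cinner_simps power_mult_distrib Re_cinner_commute[of x y]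
            algebra_simps)
    qed
    from linear_term_zero_of_quadratic_nonneg[OF this] show ?thesis by simp
  qed
  have "f x = cinner x y" for x
  proof (rule complex_eqI)
    show "Im (f x) = Im (cinner x y)"
      using real_part[of "\<i> *\<^sub>C x"] by (simp add: hom cinner_simps)
  qed (rule real_part)
  then show ?thesis by blast
qed

lemma bounded_clinear_imp_bounded_linear: "bounded_clinear A \<Longrightarrow> bounded_linear A"
  by (simp add: bounded_clinear_def)

lemma bounded_clinear_scaleC: "bounded_clinear A \<Longrightarrow> A (c *\<^sub>C x) = c *\<^sub>C A x"
  by (simp add: bounded_clinear_def)

lemma bounded_clinear_add: "bounded_clinear A \<Longrightarrow> A (x + y) = A x + A y"
  by (rule linear_add[OF bounded_linear.linear[OF bounded_clinear_imp_bounded_linear]])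

lemma bounded_clinear_diff: "bounded_clinear A \<Longrightarrow> A (x - y) = A x - A y"
  by (rule linear_diff[OF bounded_linear.linear[OF bounded_clinear_imp_bounded_linear]])

lemma bounded_clinear_scaleR: "bounded_clinear A \<Longrightarrow> A (r *\<^sub>R x) = r *\<^sub>R A x"
  by (rule linear_scale[OF bounded_linear.linear[OF bounded_clinear_imp_bounded_linear]])

lemma cinner_cadjoint_right:
  fixes A :: "'a::chilbert_space \<Rightarrow> 'a"
  assumes A: "bounded_clinear A"
  shows "cinner (A x) y = cinner x (cadjoint A y)"
proof -
  have "\<exists>z. \<forall>x. cinner (A x) y = cinner x z" for y
  proof (rule Riesz_representation)
    show "bounded_linear (\<lambda>x. cinner (A x) y)"
      using bounded_linear_compose[OF bounded_bilinear.bounded_linear_left[OF bounded_bilinear_cinner]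
          bounded_clinear_imp_bounded_linear[OF A]] .
  qed (simp add: bounded_clinear_scaleC[OF A] cinner_simps)
  then obtain B where B: "\<forall>x y. cinner (A x) y = cinner x (B y)" by metis
  have "\<exists>!B. \<forall>x y. cinner (A x) y = cinner x (B y)"
  proof (rule ex1I[of _ B])
    fix B' assume B': "\<forall>x y. cinner (A x) y = cinner x (B' y)"
    have "cinner x (B' y) = cinner x (B y)" for x y
      using B[rule_format, of x y] B'[rule_format, of x y] by simp
    then show "B' = B" by (intro ext) (rule cinner_ext)
  qed (rule B)
  from theI'[OF this] show ?thesis unfolding cadjoint_def by (elim allE)
qed

lemma cinner_cadjoint_left:
  fixes A :: "'a::chilbert_space \<Rightarrow> 'a"
  assumes A: "bounded_clinear A"
  shows "cinner (cadjoint A x) y = cinner x (A y)"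
  using cinner_cadjoint_right[OF A, of y x] cinner_commute[of "A y" x] cinner_commute[of y "cadjoint A x"]
  by simp

lemma bounded_clinear_cadjoint:
  fixes A :: "'a::chilbert_space \<Rightarrow> 'a"
  assumes A: "bounded_clinear A"
  shows "bounded_clinear (cadjoint A)"
proof -
  note adj = cinner_cadjoint_right[OF A, symmetric]
  have add: "cadjoint A (x + y) = cadjoint A x + cadjoint A y" for x y
    by (rule cinner_ext) (simp add: adj cinner_simps)
  have hom: "cadjoint A (c *\<^sub>C x) = c *\<^sub>C cadjoint A x" for c x
    by (rule cinner_ext) (simp add: adj cinner_simps)
  obtain K where K: "\<And>x. norm (A x) \<le> norm x * K"
    using bounded_linear.bounded[OF bounded_clinear_imp_bounded_linear[OF A]] by blast
  have "norm (cadjoint A y) \<le> norm y * K" for y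
  proof (cases "cadjoint A y = 0")
    case True
    then show ?thesis using order_trans[OF norm_ge_zero K[of y]] by simp
  next
    case False
    have "(norm (cadjoint A y))\<^sup>2 = Re (cinner (A (cadjoint A y)) y)"
      by (simp add: norm_sq_eq_Re_cinner adj)
    also have "\<dots> \<le> norm (A (cadjoint A y)) * norm y"
      using complex_Re_le_cmod cinner_Cauchy_Schwarz order_trans by blast
    also have "\<dots> \<le> (norm (cadjoint A y) * K) * norm y"
      using K by (intro mult_right_mono) auto
    finally have "norm (cadjoint A y) * norm (cadjoint A y) \<le> norm (cadjoint A y) * (norm y * K)"
      by (simp add: power2_eq_square algebra_simps)
    then show ?thesis using False by simp
  qed
  then have "bounded_linear (cadjoint A)"
    using add hom by (intro bounded_linear_intro[where K=K]) (auto simp: scaleC_of_real[symmetric])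
  then show ?thesis by (simp add: bounded_clinear_def hom)
qed

section \<open>Compact self-adjoint operators on invariant subspaces\<close>

lemma bounded_clinear_plus:
  assumes "bounded_clinear S" "bounded_clinear T"
  shows "bounded_clinear (\<lambda>x. S x + T x)"
  using assms unfolding bounded_clinear_def by (simp add: bounded_linear_add scaleC_add_right)

lemma bounded_clinear_scaleC_comp:
  assumes "bounded_clinear S"
  shows "bounded_clinear (\<lambda>x. c *\<^sub>C S x)"
  using assms bounded_linear_compose[OF bounded_linear_scaleC]
  unfolding bounded_clinear_def by (auto simp: scaleC_scaleC mult.commute)

lemma bounded_clinear_ident: "bounded_clinear (\<lambda>x::'a::complex_inner. x)"
  by (simp add: bounded_clinear_def bounded_linear_ident)

lemma bounded_clinear_scaleR_minus:
  assumes "bounded_clinear S"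
  shows "bounded_clinear (\<lambda>x. r *\<^sub>R x - S x)"
  using bounded_clinear_plus[OF bounded_clinear_scaleC_comp[OF bounded_clinear_ident, of "of_real r"]
      bounded_clinear_scaleC_comp[OF assms, of "-1"]]
  by (simp add: scaleC_of_real scaleC_minus_left)

definition selfadjoint :: "('a::complex_inner \<Rightarrow> 'a) \<Rightarrow> bool"
  where "selfadjoint S \<longleftrightarrow> (\<forall>x y. cinner (S x) y = cinner x (S y))"

definition seq_compact_map :: "('a::complex_inner \<Rightarrow> 'a) \<Rightarrow> bool"
  where "seq_compact_map S \<longleftrightarrow>
    (\<forall>X::nat \<Rightarrow> 'a. bounded (range X) \<longrightarrow> (\<exists>f. strict_mono f \<and> convergent (\<lambda>n. S (X (f n)))))"

definition closed_csubspace :: "'a::complex_inner set \<Rightarrow> bool"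
  where "closed_csubspace N \<longleftrightarrow> closed N \<and> 0 \<in> N \<and> (\<forall>x\<in>N. \<forall>y\<in>N. x + y \<in> N) \<and>
    (\<forall>c. \<forall>x\<in>N. c *\<^sub>C x \<in> N)"

lemma closed_csubspaceD:
  assumes "closed_csubspace N"
  shows "closed N" "0 \<in> N" "\<And>x y. x \<in> N \<Longrightarrow> y \<in> N \<Longrightarrow> x + y \<in> N"
    "\<And>c x. x \<in> N \<Longrightarrow> c *\<^sub>C x \<in> N" "\<And>r x. x \<in> N \<Longrightarrow> r *\<^sub>R x \<in> N"
    "\<And>x y. x \<in> N \<Longrightarrow> y \<in> N \<Longrightarrow> x - y \<in> N"
proof -
  show add: "x + y \<in> N" if "x \<in> N" "y \<in> N" for x y
    using assms that by (simp add: closed_csubspace_def)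
  show scaleC: "c *\<^sub>C x \<in> N" if "x \<in> N" for c x
    using assms that by (simp add: closed_csubspace_def)
  show "r *\<^sub>R x \<in> N" if "x \<in> N" for r x
    using scaleC[OF that, of "of_real r"] by (simp add: scaleC_of_real)
  show "x - y \<in> N" if "x \<in> N" "y \<in> N" for x y
    using add[OF that(1) scaleC[OF that(2), of "-1"]] by (simp add: scaleC_minus_left)
qed (use assms in \<open>auto simp: closed_csubspace_def\<close>)

lemma closed_csubspace_kernel:
  assumes T: "bounded_clinear T" and N: "closed_csubspace N"
  shows "closed_csubspace {x\<in>N. T x = 0}"
proof -
  have "continuous_on UNIV T"
    using T by (simp add: bounded_clinear_imp_bounded_linear linear_continuous_on)
  then have "closed {x. T x = 0}"
    by (intro closed_Collect_eq) auto
  then have "closed (N \<inter> {x. T x = 0})"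
    using closed_csubspaceD(1)[OF N] by (rule closed_Int[rotated])
  moreover have "T 0 = 0" using bounded_clinear_scaleR[OF T, of 0 0] by simp
  ultimately show ?thesis
    using closed_csubspaceD[OF N] unfolding closed_csubspace_def
    by (auto simp: Int_def bounded_clinear_add[OF T] bounded_clinear_scaleC[OF T])
qed

text \<open>Cauchy--Schwarz for the semi-inner product \<open>\<langle>E x, y\<rangle>\<close>, obtained from its positivity at the single
  vector \<open>x - E x / K\<close> where \<open>K\<close> bounds the norm of \<open>E\<close>. Its use is that a vector at which the form of a
  positive operator vanishes lies in the kernel.\<close>

lemma positive_form_controls_norm:
  assumes E: "bounded_clinear E" and sa: "selfadjoint E" and N: "closed_csubspace N"
    and inv: "\<And>x. x \<in> N \<Longrightarrow> E x \<in> N" and pos: "\<And>x. x \<in> N \<Longrightarrow> 0 \<le> Re (cinner (E x) x)"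
  shows "\<exists>B>0. \<forall>x\<in>N. (norm (E x))\<^sup>2 \<le> B * Re (cinner (E x) x)"
proof -
  obtain K where K: "K > 0" "\<And>x. norm (E x) \<le> norm x * K"
    using bounded_linear.pos_bounded[OF bounded_clinear_imp_bounded_linear[OF E]] by blast
  have "(norm (E x))\<^sup>2 \<le> K * Re (cinner (E x) x)" if x: "x \<in> N" for x
  proof -
    define s where "s = 1 / K"
    define y where "y = x - s *\<^sub>R E x"
    have "y \<in> N" unfolding y_def by (intro closed_csubspaceD(5,6)[OF N] x inv)
    then have "0 \<le> Re (cinner (E y) y)" by (rule pos)
    also have "\<dots> = Re (cinner (E x) x) - 2 * s * (norm (E x))\<^sup>2
        + s\<^sup>2 * Re (cinner (E (E x)) (E x))"
    proof -
      have "cinner (E (E x)) x = cinner (E x) (E x)" using sa by (simp add: selfadjoint_def)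
      then show ?thesis
        unfolding y_def norm_sq_eq_Re_cinner
        by (simp add: bounded_clinear_diff[OF E] bounded_clinear_scaleR[OF E] cinner_simps
            power2_eq_square algebra_simps)
    qed
    also have "Re (cinner (E (E x)) (E x)) \<le> K * (norm (E x))\<^sup>2"
    proof -
      have "Re (cinner (E (E x)) (E x)) \<le> norm (E (E x)) * norm (E x)"
        using complex_Re_le_cmod cinner_Cauchy_Schwarz order_trans by blast
      also have "\<dots> \<le> (norm (E x) * K) * norm (E x)"
        using K(2) by (intro mult_right_mono) auto
      finally show ?thesis by (simp add: power2_eq_square algebra_simps)
    qed
    finally have "0 \<le> Re (cinner (E x) x) - 2 * s * (norm (E x))\<^sup>2 + s\<^sup>2 * (K * (norm (E x))\<^sup>2)"
      using K(1) by (simp add: mult_left_mono)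
    then show ?thesis using K(1) by (simp add: s_def field_simps power2_eq_square)
  qed
  then show ?thesis using K(1) by blast
qed

lemma kernel_if_positive_form_zero:
  assumes E: "bounded_clinear E" and sa: "selfadjoint E" and N: "closed_csubspace N"
    and inv: "\<And>x. x \<in> N \<Longrightarrow> E x \<in> N" and pos: "\<And>x. x \<in> N \<Longrightarrow> 0 \<le> Re (cinner (E x) x)"
    and x: "x \<in> N" and zero: "Re (cinner (E x) x) = 0"
  shows "E x = 0"
proof -
  obtain B where "\<forall>x\<in>N. (norm (E x))\<^sup>2 \<le> B * Re (cinner (E x) x)"
    using positive_form_controls_norm[OF E sa N inv pos] by blast
  then have "(norm (E x))\<^sup>2 \<le> 0" using x zero by fastforce
  then show ?thesis by simp
qed

lemma selfadjoint_scaleR_minus: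
  assumes "selfadjoint S"
  shows "selfadjoint (\<lambda>x. r *\<^sub>R x - S x)"
  using assms by (simp add: selfadjoint_def cinner_simps)

text \<open>On unit vectors \<open>x\<close> with \<open>\<langle>S x, x\<rangle>\<close> close to its supremum \<open>r\<close> the positive operator \<open>r - S\<close> is small,
  so \<open>r x\<close> is close to \<open>S x\<close>, and compactness of \<open>S\<close> makes such \<open>x\<close> accumulate at an eigenvector.\<close>

lemma top_eigenvector:
  assumes S: "bounded_clinear S" and cpt: "seq_compact_map S" and sa: "selfadjoint S"
    and N: "closed_csubspace N" and inv: "\<And>x. x \<in> N \<Longrightarrow> S x \<in> N"
    and y: "y \<in> N" "Re (cinner (S y) y) > 0"
  shows "\<exists>r>0. (\<exists>x\<in>N. norm x = 1 \<and> S x = r *\<^sub>R x) \<and>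
    (\<forall>x\<in>N. Re (cinner (S x) x) \<le> r * (norm x)\<^sup>2)"
proof -
  define Q where "Q = (\<lambda>x. Re (cinner (S x) x)) ` {x\<in>N. norm x = 1}"
  obtain K where K: "\<And>x. norm (S x) \<le> norm x * K"
    using bounded_linear.bounded[OF bounded_clinear_imp_bounded_linear[OF S]] by blast
  have "Re (cinner (S x) x) \<le> K" if "norm x = 1" for x
  proof -
    have "Re (cinner (S x) x) \<le> norm (S x) * norm x"
      using complex_Re_le_cmod cinner_Cauchy_Schwarz order_trans by blast
    then show ?thesis using K[of x] that by simp
  qed
  then have bdd: "bdd_above Q" unfolding Q_def by (intro bdd_aboveI2) auto
  define r where "r = Sup Q"
  have normalize: "(inverse (norm x) *\<^sub>R x) \<in> {x\<in>N. norm x = 1}"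
    "Re (cinner (S x) x) = (norm x)\<^sup>2 * Re (cinner (S (inverse (norm x) *\<^sub>R x)) (inverse (norm x) *\<^sub>R x))"
    if "x \<in> N" "x \<noteq> 0" for x
    using that closed_csubspaceD(5)[OF N]
    by (auto simp: bounded_clinear_scaleR[OF S] cinner_simps power2_eq_square)
  have le: "Re (cinner (S x) x) \<le> r * (norm x)\<^sup>2" if "x \<in> N" for x
  proof (cases "x = 0")
    case False
    have "Re (cinner (S (inverse (norm x) *\<^sub>R x)) (inverse (norm x) *\<^sub>R x)) \<le> r"
      unfolding r_def using normalize(1)[OF that False] bdd by (intro cSup_upper) (auto simp: Q_def)
    from mult_left_mono[OF this, of "(norm x)\<^sup>2"] show ?thesis
      unfolding normalize(2)[OF that False, symmetric] by (simp add: mult.commute)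
  qed simp
  have "y \<noteq> 0" using y by auto
  have "r > 0"
  proof (rule ccontr)
    assume "\<not> r > 0"
    then have "r * (norm y)\<^sup>2 \<le> 0" by (simp add: mult_nonpos_nonneg)
    then show False using le[OF y(1)] y(2) by linarith
  qed
  have "Q \<noteq> {}" unfolding Q_def using normalize(1)[OF y(1) \<open>y \<noteq> 0\<close>] by blast
  then have "\<exists>x\<in>N. norm x = 1 \<and> r - inverse (real (Suc n)) < Re (cinner (S x) x)" for n
    using less_cSupD[of Q "r - inverse (real (Suc n))"] by (auto simp: r_def Q_def)
  then obtain X where X: "\<And>n. X n \<in> N" "\<And>n. norm (X n) = 1"
    "\<And>n. r - inverse (real (Suc n)) < Re (cinner (S (X n)) (X n))" by metis
  define E where "E x = r *\<^sub>R x - S x" for x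
  have E: "bounded_clinear E" "selfadjoint E"
    unfolding E_def using bounded_clinear_scaleR_minus[OF S] selfadjoint_scaleR_minus[OF sa] by auto
  have form: "Re (cinner (E x) x) = r * (norm x)\<^sup>2 - Re (cinner (S x) x)" for x
    by (simp add: E_def cinner_simps norm_sq_eq_Re_cinner)
  obtain B where B: "B > 0" "\<And>x. x \<in> N \<Longrightarrow> (norm (E x))\<^sup>2 \<le> B * Re (cinner (E x) x)"
    using positive_form_controls_norm[OF E N] inv closed_csubspaceD[OF N] le
    by (auto simp: form) (auto simp: E_def)
  have "(\<lambda>n. (norm (E (X n)))\<^sup>2) \<longlonglongrightarrow> 0"
  proof (rule tendsto_sandwich[OF _ _ tendsto_const])
    show "\<forall>\<^sub>F n in sequentially. (norm (E (X n)))\<^sup>2 \<le> B * inverse (real (Suc n))"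
    proof (intro always_eventually allI)
      fix n
      have "(norm (E (X n)))\<^sup>2 \<le> B * (r - Re (cinner (S (X n)) (X n)))"
        using B(2)[OF X(1)[of n]] X(2)[of n] by (simp add: form)
      also have "\<dots> \<le> B * inverse (real (Suc n))"
        using B(1) X(3)[of n] by (intro mult_left_mono) auto
      finally show "(norm (E (X n)))\<^sup>2 \<le> B * inverse (real (Suc n))" .
    qed
    show "(\<lambda>n. B * inverse (real (Suc n))) \<longlonglongrightarrow> 0"
      using tendsto_mult_right_zero[OF LIMSEQ_inverse_real_of_nat] .
  qed auto
  then have "(\<lambda>n. norm (E (X n))) \<longlonglongrightarrow> 0"
    using tendsto_real_sqrt[of "\<lambda>n. (norm (E (X n)))\<^sup>2" 0] by simp
  then have EX: "(\<lambda>n. E (X n)) \<longlonglongrightarrow> 0" by (rule tendsto_norm_zero_cancel)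
  have "bounded (range X)" using X(2) by (intro boundedI[of _ 1]) auto
  then obtain f l where f: "strict_mono f" and l: "(\<lambda>n. S (X (f n))) \<longlonglongrightarrow> l"
    using cpt unfolding seq_compact_map_def convergent_def by blast
  have EXf: "(\<lambda>n. E (X (f n))) \<longlonglongrightarrow> 0"
    using LIMSEQ_subseq_LIMSEQ[OF EX f] by (simp add: o_def)
  define x where "x = inverse r *\<^sub>R l"
  have "(\<lambda>n. inverse r *\<^sub>R (E (X (f n)) + S (X (f n)))) \<longlonglongrightarrow> inverse r *\<^sub>R (0 + l)"
    by (intro tendsto_intros EXf l)
  then have Xf: "(\<lambda>n. X (f n)) \<longlonglongrightarrow> x"
    using \<open>r > 0\<close> by (simp add: E_def x_def)
  have "x \<in> N"
    using closed_sequentially[OF closed_csubspaceD(1)[OF N] _ Xf] X(1) by blast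
  moreover have "norm x = 1"
    using tendsto_norm[OF Xf] X(2) by (simp add: LIMSEQ_const_iff)
  moreover have "E x = 0"
    using bounded_linear.tendsto[OF bounded_clinear_imp_bounded_linear[OF E(1)] Xf] EXf
      LIMSEQ_unique by blast
  then have "S x = r *\<^sub>R x" by (simp add: E_def)
  ultimately show ?thesis using \<open>r > 0\<close> le by blast
qed

lemma selfadjoint_compact_eigenvector:
  assumes S: "bounded_clinear S" and cpt: "seq_compact_map S" and sa: "selfadjoint S"
    and N: "closed_csubspace N" and inv: "\<And>x. x \<in> N \<Longrightarrow> S x \<in> N"
    and y: "y \<in> N" "S y \<noteq> 0"
  shows "\<exists>r. \<exists>x\<in>N. x \<noteq> 0 \<and> S x = r *\<^sub>R x"
proof -
  have "\<exists>x\<in>N. Re (cinner (S x) x) \<noteq> 0"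
  proof (rule ccontr)
    assume "\<not> ?thesis"
    then have "S y = 0" using y(1) by (intro kernel_if_positive_form_zero[OF S sa N inv]) auto
    then show False using y(2) by simp
  qed
  then obtain x where x: "x \<in> N" "Re (cinner (S x) x) \<noteq> 0" by blast
  show ?thesis
  proof (cases "Re (cinner (S x) x) > 0")
    case True
    from top_eigenvector[OF S cpt sa N inv x(1) True] show ?thesis by force
  next
    case False
    define T where "T = (\<lambda>x. - S x)"
    have T: "bounded_clinear T" "selfadjoint T" "\<And>x. x \<in> N \<Longrightarrow> T x \<in> N"
      using bounded_clinear_scaleR_minus[OF S, of 0] selfadjoint_scaleR_minus[OF sa, of 0]
        closed_csubspaceD(6)[OF N closed_csubspaceD(2)[OF N] inv]
      by (auto simp: T_def)
    have "seq_compact_map T"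
      using cpt by (simp add: seq_compact_map_def T_def convergent_minus_iff[symmetric])
    moreover have "Re (cinner (T x) x) > 0"
      using False x(2) by (simp add: T_def cinner_simps)
    ultimately obtain r z where "z \<in> N" "norm z = 1" "T z = r *\<^sub>R z"
      using top_eigenvector[OF T(1) _ T(2) N T(3) x(1)] by blast
    then have "z \<noteq> 0" "- (- S z) = (- r) *\<^sub>R z" by (auto simp: T_def simp del: minus_minus)
    then have "S z = (- r) *\<^sub>R z" by simp
    then show ?thesis using \<open>z \<in> N\<close> \<open>z \<noteq> 0\<close> by blast
  qed
qed

section \<open>Rotated real parts of a compact operator\<close>

text \<open>For \<open>\<bar>u\<bar> = 1\<close> this is twice the real part of \<open>u A\<close>; every self-adjoint operator in the real span of the
  real and imaginary parts of \<open>A\<close> has this form.\<close>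

definition herm_part :: "('a::chilbert_space \<Rightarrow> 'a) \<Rightarrow> complex \<Rightarrow> 'a \<Rightarrow> 'a"
  where "herm_part A u x = u *\<^sub>C A x + cnj u *\<^sub>C cadjoint A x"

lemma compact_operator_imp_bounded_clinear: "compact_operator A \<Longrightarrow> bounded_clinear A"
  by (simp add: compact_operator_def)

lemma compact_operator_imp_seq_compact_map:
  assumes "compact_operator A"
  shows "seq_compact_map A"
  unfolding seq_compact_map_def
proof (intro allI impI)
  fix X :: "nat \<Rightarrow> 'a" assume "bounded (range X)"
  then have "compact (closure (A ` range X))" using assms by (simp add: compact_operator_def)
  then have "seq_compact (closure (A ` range X))" by (rule compact_imp_seq_compact)
  moreover have "\<forall>n. A (X n) \<in> closure (A ` range X)"
    using closure_subset by fastforce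
  ultimately obtain l f where "strict_mono f" "((\<lambda>n. A (X n)) \<circ> f) \<longlonglongrightarrow> l"
    unfolding seq_compact_def by meson
  then show "\<exists>f. strict_mono f \<and> convergent (\<lambda>n. A (X (f n)))"
    by (auto simp: o_def convergent_def)
qed

text \<open>Schauder's theorem: \<open>\<parallel>A\<^sup>* v\<parallel>\<^sup>2 = \<langle>A A\<^sup>* v, v\<rangle>\<close> makes \<open>A\<^sup>* x\<^sub>n\<close> Cauchy wherever \<open>A A\<^sup>* x\<^sub>n\<close> is.\<close>

lemma seq_compact_map_cadjoint:
  fixes A :: "'a::chilbert_space \<Rightarrow> 'a"
  assumes "compact_operator A"
  shows "seq_compact_map (cadjoint A)"
  unfolding seq_compact_map_def
proof (intro allI impI)
  fix X :: "nat \<Rightarrow> 'a" assume bdd: "bounded (range X)"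
  note A = compact_operator_imp_bounded_clinear[OF assms]
  note A' = bounded_clinear_cadjoint[OF A]
  obtain M where M: "M > 0" "\<And>n. norm (X n) \<le> M" using bdd unfolding bounded_pos by auto
  have "bounded (range (\<lambda>n. cadjoint A (X n)))"
    using bounded_linear_image[OF bdd bounded_clinear_imp_bounded_linear[OF A']]
    by (simp add: image_image)
  then obtain f where f: "strict_mono f" "convergent (\<lambda>n. A (cadjoint A (X (f n))))"
    using compact_operator_imp_seq_compact_map[OF assms] unfolding seq_compact_map_def by blast
  have "Cauchy (\<lambda>n. cadjoint A (X (f n)))"
  proof (rule metric_CauchyI)
    fix e :: real assume "e > 0"
    then have "e\<^sup>2 / (2 * M) > 0" using M by simp
    then obtain m where m: "\<And>i j. i \<ge> m \<Longrightarrow> j \<ge> m \<Longrightarrow>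
        dist (A (cadjoint A (X (f i)))) (A (cadjoint A (X (f j)))) < e\<^sup>2 / (2 * M)"
      using metric_CauchyD[OF convergent_Cauchy[OF f(2)]] by blast
    have "dist (cadjoint A (X (f i))) (cadjoint A (X (f j))) < e" if "i \<ge> m" "j \<ge> m" for i j
    proof -
      define v where "v = X (f i) - X (f j)"
      have v: "norm v \<le> 2 * M"
        using norm_triangle_ineq4[of "X (f i)" "X (f j)"] M(2)[of "f i"] M(2)[of "f j"]
        by (simp add: v_def)
      have "(norm (cadjoint A v))\<^sup>2 = Re (cinner (A (cadjoint A v)) v)"
        by (simp add: norm_sq_eq_Re_cinner cinner_cadjoint_right[OF A])
      also have "\<dots> \<le> norm (A (cadjoint A v)) * norm v"
        using complex_Re_le_cmod cinner_Cauchy_Schwarz order_trans by blast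
      also have "\<dots> \<le> norm (A (cadjoint A v)) * (2 * M)"
        using v by (intro mult_left_mono) auto
      also have "\<dots> < e\<^sup>2 / (2 * M) * (2 * M)"
        using m[OF that] M(1)
        by (intro mult_strict_right_mono)
          (auto simp: v_def bounded_clinear_diff[OF A'] bounded_clinear_diff[OF A] dist_norm)
      also have "\<dots> = e\<^sup>2" using M(1) by simp
      finally have "norm (cadjoint A v) < e"
        using \<open>e > 0\<close> by (simp add: power_less_imp_less_base)
      then show ?thesis by (simp add: v_def bounded_clinear_diff[OF A'] dist_norm)
    qed
    then show "\<exists>m. \<forall>i\<ge>m. \<forall>j\<ge>m. dist (cadjoint A (X (f i))) (cadjoint A (X (f j))) < e" by blast
  qed
  then show "\<exists>f. strict_mono f \<and> convergent (\<lambda>n. cadjoint A (X (f n)))"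
    using f(1) Cauchy_convergent_iff by blast
qed

lemma bounded_clinear_herm_part: "bounded_clinear A \<Longrightarrow> bounded_clinear (herm_part A u)"
  unfolding herm_part_def
  by (intro bounded_clinear_plus bounded_clinear_scaleC_comp bounded_clinear_cadjoint)

lemma selfadjoint_herm_part: "bounded_clinear A \<Longrightarrow> selfadjoint (herm_part A u)"
  unfolding selfadjoint_def herm_part_def
  by (simp add: cinner_simps cinner_cadjoint_right cinner_cadjoint_left)

lemma seq_compact_map_herm_part:
  fixes A :: "'a::chilbert_space \<Rightarrow> 'a"
  assumes "compact_operator A"
  shows "seq_compact_map (herm_part A u)"
  unfolding seq_compact_map_def
proof (intro allI impI)
  fix X :: "nat \<Rightarrow> 'a" assume bdd: "bounded (range X)"
  obtain f where f: "strict_mono f" "convergent (\<lambda>n. A (X (f n)))"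
    using compact_operator_imp_seq_compact_map[OF assms] bdd unfolding seq_compact_map_def by blast
  have "bounded (range (X \<circ> f))" using bdd by (rule bounded_subset) auto
  then obtain g where g: "strict_mono g" "convergent (\<lambda>n. cadjoint A (X (f (g n))))"
    using seq_compact_map_cadjoint[OF assms] unfolding seq_compact_map_def by fastforce
  have "convergent (\<lambda>n. A (X (f (g n))))"
    using convergent_subseq_convergent[OF f(2) g(1)] by (simp add: o_def)
  then obtain a where a: "(\<lambda>n. A (X (f (g n)))) \<longlonglongrightarrow> a" by (auto simp: convergent_def)
  obtain b where b: "(\<lambda>n. cadjoint A (X (f (g n)))) \<longlonglongrightarrow> b"
    using g(2) by (auto simp: convergent_def)
  have "(\<lambda>n. herm_part A u (X (f (g n)))) \<longlonglongrightarrow> u *\<^sub>C a + cnj u *\<^sub>C b"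
    unfolding herm_part_def
    by (intro tendsto_add bounded_linear.tendsto[OF bounded_linear_scaleC] a b)
  then have "convergent (\<lambda>n. herm_part A u (X (f (g n))))" by (auto simp: convergent_def)
  then show "\<exists>f. strict_mono f \<and> convergent (\<lambda>n. herm_part A u (X (f n)))"
    using strict_mono_o[OF f(1) g(1)] by (intro exI[of _ "f \<circ> g"]) simp
qed

lemma Re_cinner_herm_part:
  assumes "bounded_clinear A"
  shows "Re (cinner (herm_part A u x) x) = 2 * Re (u * cinner (A x) x)"
proof -
  have "cinner (herm_part A u x) x = u * cinner (A x) x + cnj (u * cinner (A x) x)"
    using cinner_commute[of x "A x"]
    by (simp add: herm_part_def cinner_simps cinner_cadjoint_left[OF assms])
  then show ?thesis by (simp only: complex_add_cnj) simp
qed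

lemma herm_part_i:
  "herm_part A u x + (- \<i>) *\<^sub>C herm_part A (\<i> * u) x = (2 * u) *\<^sub>C A x"
  "herm_part A u x + \<i> *\<^sub>C herm_part A (\<i> * u) x = (2 * cnj u) *\<^sub>C cadjoint A x"
  by (simp_all add: herm_part_def scaleC_simps mult.assoc[symmetric])
    (simp_all add: scaleC_add_left[symmetric])

definition reducing :: "('a::chilbert_space \<Rightarrow> 'a) \<Rightarrow> 'a set \<Rightarrow> bool"
  where "reducing A N \<longleftrightarrow> closed_csubspace N \<and> (\<forall>x\<in>N. A x \<in> N \<and> cadjoint A x \<in> N)"

lemma herm_part_in_reducing: "reducing A N \<Longrightarrow> x \<in> N \<Longrightarrow> herm_part A u x \<in> N"
  by (simp add: reducing_def herm_part_def closed_csubspaceD)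

definition joint_eigenvector :: "('a::chilbert_space \<Rightarrow> 'a) \<Rightarrow> complex \<Rightarrow> 'a \<Rightarrow> bool"
  where "joint_eigenvector A l x \<longleftrightarrow> x \<noteq> 0 \<and> A x = l *\<^sub>C x \<and> cadjoint A x = cnj l *\<^sub>C x"

text \<open>The summands \<open>u A\<close> and \<open>cnj u A\<^sup>*\<close> of a rotated real part are recovered from it and from the one rotated
  by a further quarter turn, and both of these have real eigenvalues.\<close>

lemma joint_eigenvector_if_herm_part_eigenvector:
  assumes "x \<noteq> 0" and u: "cmod u = 1"
    and re: "herm_part A u x = a *\<^sub>R x" and im: "herm_part A (\<i> * u) x = b *\<^sub>R x"
  shows "joint_eigenvector A (cnj u * Complex a (- b) / 2) x"
proof -
  have uu: "cnj u * u = 1" using u complex_norm_square[of u] by (simp add: mult.commute)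
  have "(2 * u) *\<^sub>C A x = Complex a (- b) *\<^sub>C x"
    using herm_part_i(1)[of A u x] unfolding re im
    by (simp add: scaleC_of_real[symmetric] scaleC_scaleC scaleC_add_left[symmetric]
        complex_eq_iff Complex_eq)
  then have "(cnj u / 2) *\<^sub>C (2 * u) *\<^sub>C A x = (cnj u / 2) *\<^sub>C Complex a (- b) *\<^sub>C x" by simp
  then have 1: "A x = (cnj u * Complex a (- b) / 2) *\<^sub>C x"
    by (simp add: scaleC_scaleC uu)
  have "(2 * cnj u) *\<^sub>C cadjoint A x = Complex a b *\<^sub>C x"
    using herm_part_i(2)[of A u x] unfolding re im
    by (simp add: scaleC_of_real[symmetric] scaleC_scaleC scaleC_add_left[symmetric]
        complex_eq_iff Complex_eq)
  then have "(u / 2) *\<^sub>C (2 * cnj u) *\<^sub>C cadjoint A x = (u / 2) *\<^sub>C Complex a b *\<^sub>C x" by simp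
  then have 2: "cadjoint A x = cnj (cnj u * Complex a (- b) / 2) *\<^sub>C x"
    using uu by (simp add: scaleC_scaleC mult.commute complex_cnj)
  show ?thesis using \<open>x \<noteq> 0\<close> 1 2 by (simp add: joint_eigenvector_def)
qed

lemma herm_parts_vanish_imp_zero:
  assumes "herm_part A 1 x = 0" "herm_part A \<i> x = 0"
  shows "A x = 0"
  using herm_part_i(1)[of A 1 x] assms by simp

lemma herm_part_of_normal_commutes:
  assumes A: "bounded_clinear A" and norm: "normal_operator A"
  shows "A (herm_part A u x) = herm_part A u (A x)"
    and "cadjoint A (herm_part A u x) = herm_part A u (cadjoint A x)"
  using fun_cong[OF norm[unfolded normal_operator_def], of x] bounded_clinear_cadjoint[OF A] A
  by (simp_all add: herm_part_def bounded_clinear_add bounded_clinear_scaleC)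

text \<open>Both steps restrict to an eigenspace, which is reducing because everything commutes: first for one
  of the two real parts of \<open>A\<close>, then for the other one inside that eigenspace.\<close>

lemma joint_eigenvector_of_normal:
  assumes cpt: "compact_operator A" and norm: "normal_operator A" and N: "reducing A N"
    and y: "y \<in> N" "A y \<noteq> 0"
  shows "\<exists>x\<in>N. \<exists>l. joint_eigenvector A l x"
proof -
  note A = compact_operator_imp_bounded_clinear[OF cpt]
  note H = bounded_clinear_herm_part[OF A] seq_compact_map_herm_part[OF cpt]
    selfadjoint_herm_part[OF A]
  have "herm_part A 1 y \<noteq> 0 \<or> herm_part A \<i> y \<noteq> 0"
    using herm_parts_vanish_imp_zero y(2) by blast
  then obtain u where u: "cmod u = 1" "herm_part A u y \<noteq> 0"
    by (metis norm_ii norm_one)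
  obtain a x where x: "x \<in> N" "x \<noteq> 0" "herm_part A u x = a *\<^sub>R x"
    using selfadjoint_compact_eigenvector[OF H _ herm_part_in_reducing[OF N] y(1) u(2)] N
    unfolding reducing_def by blast
  define M where "M = {x\<in>N. a *\<^sub>R x - herm_part A u x = 0}"
  have M: "reducing A M"
    unfolding reducing_def
  proof (intro conjI ballI)
    show "closed_csubspace M"
      unfolding M_def using N bounded_clinear_scaleR_minus[OF H(1)]
      by (intro closed_csubspace_kernel) (auto simp: reducing_def)
    fix x assume "x \<in> M"
    then have "x \<in> N" and eq: "herm_part A u x = a *\<^sub>R x" by (auto simp: M_def)
    have "herm_part A u (A x) = a *\<^sub>R A x"
      "herm_part A u (cadjoint A x) = a *\<^sub>R cadjoint A x"
      using eq bounded_clinear_cadjoint[OF A]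
      by (simp_all add: herm_part_of_normal_commutes[OF A norm, symmetric]
          bounded_clinear_scaleR[OF A] bounded_clinear_scaleR)
    then show "A x \<in> M" "cadjoint A x \<in> M"
      using N \<open>x \<in> N\<close> by (auto simp: M_def reducing_def)
  qed
  have "x \<in> M" using x by (simp add: M_def)
  have "\<exists>b. \<exists>v\<in>M. v \<noteq> 0 \<and> herm_part A (\<i> * u) v = b *\<^sub>R v"
  proof (cases "herm_part A (\<i> * u) x = 0")
    case True
    then show ?thesis using \<open>x \<in> M\<close> x(2) by (intro exI[of _ 0] bexI[of _ x]) auto
  next
    case False
    show ?thesis
      using selfadjoint_compact_eigenvector[OF H _ herm_part_in_reducing[OF M] \<open>x \<in> M\<close> False] M
      unfolding reducing_def by blast
  qed
  then obtain b v where "v \<in> M" "v \<noteq> 0" "herm_part A (\<i> * u) v = b *\<^sub>R v" by blast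
  then show ?thesis
    using joint_eigenvector_if_herm_part_eigenvector[OF _ u(1), of v A a b] by (auto simp: M_def)
qed

lemma joint_eigenvectors_orthogonal:
  assumes A: "bounded_clinear A" and "joint_eigenvector A l x" "joint_eigenvector A m y" "l \<noteq> m"
  shows "cinner x y = 0"
proof -
  have "l * cinner x y = cinner (A x) y" using assms by (simp add: joint_eigenvector_def cinner_simps)
  also have "\<dots> = cinner x (cadjoint A y)" by (rule cinner_cadjoint_right[OF A])
  also have "\<dots> = m * cinner x y" using assms by (simp add: joint_eigenvector_def cinner_simps)
  finally show ?thesis using \<open>l \<noteq> m\<close> by simp
qed

lemma joint_eigenvector_normalize:
  assumes A: "bounded_clinear A" and "joint_eigenvector A l x"
  shows "\<exists>x. norm x = 1 \<and> joint_eigenvector A l x"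
  using assms bounded_clinear_cadjoint[OF A] unfolding joint_eigenvector_def
  by (intro exI[of _ "of_real (inverse (norm x)) *\<^sub>C x"])
    (simp add: norm_scaleC norm_inverse bounded_clinear_scaleC scaleC_scaleC mult.commute)

text \<open>Infinitely many distinct eigenvalues of modulus at least \<open>e\<close> would give orthonormal eigenvectors
  whose images under \<open>A\<close> have mutual distance at least \<open>e\<close>.\<close>

lemma finite_large_joint_eigenvalues:
  assumes cpt: "compact_operator A" and "e > 0"
  shows "finite {l. cmod l \<ge> e \<and> (\<exists>x. joint_eigenvector A l x)}"
proof (rule ccontr)
  note A = compact_operator_imp_bounded_clinear[OF cpt]
  assume "infinite {l. cmod l \<ge> e \<and> (\<exists>x. joint_eigenvector A l x)}"
  then obtain l :: "nat \<Rightarrow> complex" where l: "inj l"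
    "range l \<subseteq> {l. cmod l \<ge> e \<and> (\<exists>x. joint_eigenvector A l x)}"
    using infinite_countable_subset by blast
  then have le: "cmod (l n) \<ge> e" and "\<exists>x. norm x = 1 \<and> joint_eigenvector A (l n) x" for n
    using joint_eigenvector_normalize[OF A] by blast+
  then obtain X where X: "\<And>n. norm (X n) = 1" "\<And>n. joint_eigenvector A (l n) (X n)" by metis
  have "bounded (range X)" using X(1) by (intro boundedI[of _ 1]) auto
  then obtain f where f: "strict_mono f" "convergent (\<lambda>n. A (X (f n)))"
    using compact_operator_imp_seq_compact_map[OF cpt] unfolding seq_compact_map_def by blast
  from metric_CauchyD[OF convergent_Cauchy[OF f(2)] \<open>e > 0\<close>]
  obtain m where m: "\<And>i j. i \<ge> m \<Longrightarrow> j \<ge> m \<Longrightarrow> dist (A (X (f i))) (A (X (f j))) < e" by blast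
  define i j where "i = f m" and "j = f (Suc m)"
  have "l j \<noteq> l i" using l(1) f(1) by (auto simp: i_def j_def inj_eq strict_mono_eq)
  then have "cinner (A (X i) - A (X j)) (X i) = l i"
    using X(2) joint_eigenvectors_orthogonal[OF A X(2) X(2), of j i]
    by (simp add: cinner_simps joint_eigenvector_def cinner_self X(1))
  then have "cmod (l i) \<le> dist (A (X i)) (A (X j))"
    using cinner_Cauchy_Schwarz[of "A (X i) - A (X j)" "X i"] X(1) by (simp add: dist_norm)
  also have "\<dots> < e" using m[of m "Suc m"] by (simp add: i_def j_def)
  finally show False using le[of i] by simp
qed

section \<open>Complex lines in the plane\<close>

text \<open>These are the lines that miss the origin, and the joint point spectrum misses the origin.\<close>

definition dual_line :: "complex \<Rightarrow> complex \<Rightarrow> (complex ^ 2) set"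
  where "dual_line l m = {z. l * z $ 1 + m * z $ 2 = - 1}"

lemma complex_line_dual_line:
  assumes "l \<noteq> 0"
  shows "complex_line (dual_line l m)"
proof -
  define v :: "complex ^ 2" where "v = vector [m, - l]"
  define p :: "complex ^ 2" where "p = vector [- 1 / l, 0]"
  have v: "v \<noteq> 0" using assms by (auto simp: v_def vec_eq_iff forall_2)
  have "dual_line l m = (\<lambda>v. p + v) ` vec.span {v}"
  proof (intro set_eqI iffI)
    fix z assume "z \<in> dual_line l m"
    then have "l * z $ 1 = - 1 - m * z $ 2" by (simp add: dual_line_def eq_diff_eq)
    then have "z = p + (- z $ 2 / l) *s v"
      using assms by (simp add: vec_eq_iff forall_2 p_def v_def field_simps)
    then show "z \<in> (\<lambda>v. p + v) ` vec.span {v}"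
      unfolding vec.span_singleton by blast
  next
    fix z assume "z \<in> (\<lambda>v. p + v) ` vec.span {v}"
    then obtain c where "z = p + c *s v" unfolding vec.span_singleton by blast
    then show "z \<in> dual_line l m"
      using assms by (simp add: dual_line_def p_def v_def field_simps)
  qed
  moreover have "vec.dim (vec.span {v}) = 1"
    using v vec.dim_eq_card_independent[of "{v}"] by (simp add: vec.dim_span)
  ultimately show ?thesis unfolding complex_line_def using vec.subspace_span by blast
qed

text \<open>If \<open>p + c v\<close> parametrizes a line that misses the origin, then \<open>p\<close> and \<open>v\<close> are linearly independent, so
  Cramer's rule yields the functional that is \<open>-1\<close> at \<open>p\<close> and \<open>0\<close> at \<open>v\<close>.\<close>

lemma complex_line_subset_dual_line:
  assumes "complex_line L" and "0 \<notin> L"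
  shows "\<exists>l m. L \<subseteq> dual_line l m"
proof -
  obtain p V where V: "vec.subspace V" "vec.dim V = 1" and L: "L = (\<lambda>v. p + v) ` V"
    using assms(1) unfolding complex_line_def by blast
  obtain B where B: "B \<subseteq> V" "vec.independent B" "V \<subseteq> vec.span B" "card B = vec.dim V"
    by (rule vec.basis_exists[of V])
  then obtain v where "B = {v}" using V(2) by (metis card_1_singletonE)
  with B have v: "v \<in> V" "V \<subseteq> range (\<lambda>c. c *s v)" "v \<noteq> 0"
    using vec.dependent_zero[of B] by (auto simp: vec.span_singleton)
  have not_multiple: False if "p = c *s v" for c
  proof -
    have "(- c) *s v \<in> V" using V(1) v(1) by (rule vec.subspace_scale)
    then show False using assms(2) that unfolding L by force
  qed
  define d where "d = p $ 1 * v $ 2 - p $ 2 * v $ 1"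
  have "d \<noteq> 0"
  proof
    assume d: "d = 0"
    from v(3) consider "v $ 1 \<noteq> 0" | "v $ 2 \<noteq> 0" by (auto simp: vec_eq_iff forall_2)
    then show False
    proof cases
      case 1
      then have "p = (p $ 1 / v $ 1) *s v"
        using d by (simp add: vec_eq_iff forall_2 d_def field_simps)
      then show False by (rule not_multiple)
    next
      case 2
      then have "p = (p $ 2 / v $ 2) *s v"
        using d by (simp add: vec_eq_iff forall_2 d_def field_simps)
      then show False by (rule not_multiple)
    qed
  qed
  have "z \<in> dual_line (- v $ 2 / d) (v $ 1 / d)" if "z \<in> L" for z
  proof -
    obtain c where z: "z = p + c *s v" using \<open>z \<in> L\<close> v(2) unfolding L by blast
    have "- v $ 2 * z $ 1 + v $ 1 * z $ 2 = - d" by (simp add: z d_def algebra_simps)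
    then have "(- v $ 2 * z $ 1 + v $ 1 * z $ 2) / d = - 1" using \<open>d \<noteq> 0\<close> by simp
    then show ?thesis by (simp add: dual_line_def add_divide_distrib diff_divide_distrib)
  qed
  then show ?thesis by blast
qed

lemma finite_meeting_compact_if_locally_finite:
  assumes lf: "locally_finite_in euclidean \<L>" and "compact K"
  shows "finite {L\<in>\<L>. L \<inter> K \<noteq> {}}"
proof -
  have "\<forall>x. \<exists>V. open V \<and> x \<in> V \<and> finite {L\<in>\<L>. L \<inter> V \<noteq> {}}"
    using lf unfolding locally_finite_in_def by simp
  then obtain V where V: "\<And>x. open (V x)" "\<And>x. x \<in> V x"
    "\<And>x. finite {L\<in>\<L>. L \<inter> V x \<noteq> {}}" by metis
  obtain T where T: "finite T" "K \<subseteq> (\<Union>x\<in>T. V x)"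
    using compactE_image[OF \<open>compact K\<close>, of K V] V(1,2) by (metis UN_I subsetI)
  have "{L\<in>\<L>. L \<inter> K \<noteq> {}} \<subseteq> (\<Union>x\<in>T. {L\<in>\<L>. L \<inter> V x \<noteq> {}})"
    using T(2) by blast
  then show ?thesis by (rule finite_subset) (simp add: T(1) V(3))
qed

lemma norm_vec2_le: "norm (z :: complex ^ 2) \<le> cmod (z $ 1) + cmod (z $ 2)"
  unfolding norm_vec_def using L2_set_le_sum[of UNIV "\<lambda>i. cmod (z $ i)"] by (simp add: UNIV_2)

section \<open>The joint point spectrum\<close>

lemma joint_point_spectrum_iff:
  assumes A: "bounded_clinear A"
  shows "z \<in> joint_point_spectrum A (cadjoint A) \<longleftrightarrow>
    (\<exists>x. x \<noteq> 0 \<and> x + z $ 1 *\<^sub>C A x + z $ 2 *\<^sub>C cadjoint A x = 0)"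
proof -
  have "A 0 = 0" "cadjoint A 0 = 0"
    using bounded_clinear_scaleR[OF A, of 0 0]
      bounded_clinear_scaleR[OF bounded_clinear_cadjoint[OF A], of 0 0] by simp_all
  then have "0 \<in> {x. x + z $ 1 *\<^sub>C A x + z $ 2 *\<^sub>C cadjoint A x = 0}" by simp
  moreover have "S \<noteq> {0} \<longleftrightarrow> (\<exists>x. x \<noteq> 0 \<and> x \<in> S)" if "0 \<in> S" for S :: "'a set"
    using that by blast
  ultimately show ?thesis unfolding joint_point_spectrum_def mem_Collect_eq by simp
qed

text \<open>The kernel of \<open>I + z\<^sub>1 A + z\<^sub>2 A\<^sup>*\<close> reduces a normal \<open>A\<close>, and \<open>A\<close> does not vanish on it, so it contains a
  joint eigenvector.\<close>

lemma joint_point_spectrum_normal: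
  assumes cpt: "compact_operator A" and norm: "normal_operator A"
  shows "joint_point_spectrum A (cadjoint A) =
    (\<Union>l\<in>{l. l \<noteq> 0 \<and> (\<exists>x. joint_eigenvector A l x)}. dual_line l (cnj l))"
proof (intro set_eqI iffI)
  note A = compact_operator_imp_bounded_clinear[OF cpt]
  note A' = bounded_clinear_cadjoint[OF A]
  have ker: "x + z $ 1 *\<^sub>C A x + z $ 2 *\<^sub>C cadjoint A x = (1 + (l * z $ 1 + cnj l * z $ 2)) *\<^sub>C x"
    if "joint_eigenvector A l x" for l x and z :: "complex ^ 2"
    using that by (simp add: joint_eigenvector_def scaleC_simps mult.commute add.assoc)
  fix z :: "complex ^ 2"
  {
    assume "z \<in> joint_point_spectrum A (cadjoint A)"
    then obtain y where y: "y \<noteq> 0" "y + z $ 1 *\<^sub>C A y + z $ 2 *\<^sub>C cadjoint A y = 0"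
      using joint_point_spectrum_iff[OF A] by blast
    define T where "T x = x + z $ 1 *\<^sub>C A x + z $ 2 *\<^sub>C cadjoint A x" for x
    define N where "N = {x\<in>UNIV. T x = 0}"
    have T: "bounded_clinear T"
      unfolding T_def
      by (intro bounded_clinear_plus bounded_clinear_scaleC_comp bounded_clinear_ident A A')
    have comm: "A (cadjoint A x) = cadjoint A (A x)" for x
      using fun_cong[OF norm[unfolded normal_operator_def], of x] by simp
    have "A (T x) = T (A x)" "cadjoint A (T x) = T (cadjoint A x)" for x
      by (simp_all add: T_def comm bounded_clinear_add[OF A] bounded_clinear_add[OF A']
          bounded_clinear_scaleC[OF A] bounded_clinear_scaleC[OF A'])
    moreover have "A 0 = 0" "cadjoint A 0 = 0"
      using bounded_clinear_scaleR[OF A, of 0 0] bounded_clinear_scaleR[OF A', of 0 0] by simp_all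
    ultimately have "T (A x) = 0" "T (cadjoint A x) = 0" if "T x = 0" for x
      using that by metis+
    moreover have "closed_csubspace N"
      unfolding N_def by (rule closed_csubspace_kernel[OF T]) (simp add: closed_csubspace_def)
    ultimately have N: "reducing A N" by (simp add: reducing_def N_def)
    have "y \<in> N" using y by (simp add: N_def T_def)
    have "A y \<noteq> 0"
    proof
      assume "A y = 0"
      then have "(norm (cadjoint A y))\<^sup>2 = 0"
        by (simp add: norm_sq_eq_Re_cinner cinner_cadjoint_left[OF A] comm \<open>cadjoint A 0 = 0\<close>)
      then show False using y \<open>A y = 0\<close> by simp
    qed
    then obtain x l where "x \<in> N" and x: "joint_eigenvector A l x"
      using joint_eigenvector_of_normal[OF cpt norm N \<open>y \<in> N\<close>] by blast
    then have "(1 + (l * z $ 1 + cnj l * z $ 2)) *\<^sub>C x = 0" "x \<noteq> 0"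
      using ker[OF x] by (simp_all add: N_def T_def joint_eigenvector_def)
    then have "1 + (l * z $ 1 + cnj l * z $ 2) = 0" by simp
    then have "l * z $ 1 + cnj l * z $ 2 = - 1" by (simp add: eq_neg_iff_add_eq_0 add.commute)
    moreover from this have "l \<noteq> 0" by auto
    ultimately show "z \<in> (\<Union>l\<in>{l. l \<noteq> 0 \<and> (\<exists>x. joint_eigenvector A l x)}. dual_line l (cnj l))"
      using x by (auto simp: dual_line_def)
  }
  {
    assume "z \<in> (\<Union>l\<in>{l. l \<noteq> 0 \<and> (\<exists>x. joint_eigenvector A l x)}. dual_line l (cnj l))"
    then obtain l x where x: "joint_eigenvector A l x" and line: "l * z $ 1 + cnj l * z $ 2 = - 1"
      by (auto simp: dual_line_def)
    have "x + z $ 1 *\<^sub>C A x + z $ 2 *\<^sub>C cadjoint A x = 0"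
      unfolding ker[OF x] line by simp
    then show "z \<in> joint_point_spectrum A (cadjoint A)"
      unfolding joint_point_spectrum_iff[OF A]
      using x by (intro exI[of _ x]) (simp add: joint_eigenvector_def)
  }
qed

text \<open>A line \<open>dual_line l (cnj l)\<close> that meets the ball of radius \<open>R\<close> has \<open>1 \<le> 2 R \<bar>l\<bar>\<close>.\<close>

lemma locally_finite_dual_lines:
  assumes fin: "\<And>e. e > 0 \<Longrightarrow> finite {l\<in>S. cmod l \<ge> e}"
  shows "locally_finite_in euclidean ((\<lambda>l. dual_line l (cnj l)) ` S)"
  unfolding locally_finite_in_def
proof (intro conjI ballI)
  fix p :: "complex ^ 2"
  define R where "R = norm p + 1"
  have "R > 0" by (simp add: R_def add_nonneg_pos)
  have large: "1 / (2 * R) \<le> cmod l" if "z \<in> dual_line l (cnj l)" "z \<in> ball p 1" for l z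
  proof -
    have "norm z \<le> R"
      using that(2) norm_triangle_ineq2[of z p] by (simp add: R_def dist_norm norm_minus_commute)
    then have z: "cmod (z $ i) \<le> R" for i
      using Finite_Cartesian_Product.norm_nth_le[of z i] by linarith
    have "1 = cmod (l * z $ 1 + cnj l * z $ 2)" using that(1) by (simp add: dual_line_def)
    also have "\<dots> \<le> cmod l * cmod (z $ 1) + cmod l * cmod (z $ 2)"
      using norm_triangle_ineq[of "l * z $ 1" "cnj l * z $ 2"] by (simp add: norm_mult)
    also have "\<dots> \<le> cmod l * R + cmod l * R" by (intro add_mono mult_left_mono z) auto
    finally show ?thesis using \<open>R > 0\<close> by (simp add: field_simps)
  qed
  have "{U \<in> (\<lambda>l. dual_line l (cnj l)) ` S. U \<inter> ball p 1 \<noteq> {}}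
      \<subseteq> (\<lambda>l. dual_line l (cnj l)) ` {l\<in>S. cmod l \<ge> 1 / (2 * R)}"
    using large by blast
  then have "finite {U \<in> (\<lambda>l. dual_line l (cnj l)) ` S. U \<inter> ball p 1 \<noteq> {}}"
    by (rule finite_subset) (use fin[of "1 / (2 * R)"] \<open>R > 0\<close> in simp)
  then show "\<exists>V. openin euclidean V \<and> p \<in> V \<and>
      finite {U \<in> (\<lambda>l. dual_line l (cnj l)) ` S. U \<inter> V \<noteq> {}}"
    by (intro exI[of _ "ball p 1"]) simp
qed simp

lemma countable_if_finite_large:
  fixes S :: "complex set"
  assumes fin: "\<And>e. e > 0 \<Longrightarrow> finite {l\<in>S. cmod l \<ge> e}" and "0 \<notin> S"
  shows "countable S"
proof -
  have "S \<subseteq> (\<Union>n. {l\<in>S. cmod l \<ge> inverse (real (Suc n))})"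
  proof
    fix l assume "l \<in> S"
    then obtain n where "inverse (real (Suc n)) < cmod l"
      using reals_Archimedean[of "cmod l"] \<open>0 \<notin> S\<close> by auto
    then show "l \<in> (\<Union>n. {l\<in>S. cmod l \<ge> inverse (real (Suc n))})"
      using \<open>l \<in> S\<close> by (auto intro: less_imp_le)
  qed
  moreover have "countable (\<Union>n. {l\<in>S. cmod l \<ge> inverse (real (Suc n))})"
    by (simp add: countable_finite fin)
  ultimately show ?thesis by (rule countable_subset)
qed

section \<open>From lines to joint eigenvectors\<close>

text \<open>A candidate \<open>p + t q\<close> that agrees with \<open>s\<close> at arbitrarily small \<open>t\<close> must have \<open>p = k\<close> by continuity and
  \<open>q = 0\<close> because \<open>t q\<close> would lie between \<open>0\<close> and \<open>K t\<^sup>2\<close>.\<close>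

lemma constant_near_0_if_finitely_many_lines:
  fixes s :: "real \<Rightarrow> real"
  assumes fin: "finite F" and mem: "\<And>t. \<bar>t\<bar> \<le> 1 \<Longrightarrow> \<exists>(p, q)\<in>F. s t = p + t * q"
    and bounds: "\<And>t. k \<le> s t" "\<And>t. s t \<le> k + K * t\<^sup>2"
  shows "\<exists>d>0. \<forall>t. \<bar>t\<bar> < d \<longrightarrow> s t = k"
proof -
  have K: "K \<ge> 0" using order_trans[OF bounds, of 1] by simp
  have "\<forall>\<^sub>F t in nhds 0. s t = fst a + t * snd a \<longrightarrow> s t = k" for a :: "real \<times> real"
  proof -
    obtain p q where a: "a = (p, q)" by fastforce
    consider "p \<noteq> k" | "p = k" "q = 0" | "p = k" "q \<noteq> 0" by blast
    then show ?thesis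
    proof cases
      case 1
      have "((\<lambda>t. \<bar>p + t * q - k\<bar> - K * t\<^sup>2) \<longlongrightarrow> \<bar>p + 0 * q - k\<bar> - K * 0\<^sup>2) (nhds 0)"
        by (intro tendsto_intros filterlim_ident)
      then have "\<forall>\<^sub>F t in nhds 0. 0 < \<bar>p + t * q - k\<bar> - K * t\<^sup>2"
        using 1 by (intro order_tendstoD) auto
      then show ?thesis
      proof eventually_elim
        case (elim t)
        then show ?case using bounds[of t] a by auto
      qed
    next
      case 3
      have "((\<lambda>t. K * \<bar>t\<bar>) \<longlongrightarrow> K * \<bar>0\<bar>) (nhds (0::real))"
        by (intro tendsto_intros filterlim_ident)
      then have "\<forall>\<^sub>F t in nhds 0. K * \<bar>t\<bar> < \<bar>q\<bar>"
        using 3 by (intro order_tendstoD) auto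
      then show ?thesis
      proof eventually_elim
        case (elim t)
        show ?case
        proof
          assume eq: "s t = fst a + t * snd a"
          then have "\<bar>t\<bar> * \<bar>q\<bar> \<le> \<bar>t\<bar> * (K * \<bar>t\<bar>)"
            using bounds[of t] a 3(1) by (simp add: abs_mult[symmetric] power2_eq_square ac_simps)
          then have "t = 0" using elim by (metis abs_zero mult_le_cancel_left_pos not_less zero_less_abs_iff)
          then show "s t = k" using eq a 3(1) by simp
        qed
      qed
    qed (auto simp: a)
  qed
  then have "\<forall>\<^sub>F t in nhds 0. \<forall>a\<in>F. s t = fst a + t * snd a \<longrightarrow> s t = k"
    using fin by (intro eventually_ball_finite) auto
  then obtain d where d: "d > 0" "\<And>t a. \<bar>t\<bar> < d \<Longrightarrow> a \<in> F \<Longrightarrow> s t = fst a + t * snd a \<Longrightarrow> s t = k"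
    unfolding eventually_nhds_metric by (auto simp: dist_real_def)
  have "s t = k" if "\<bar>t\<bar> < min d 1" for t
    using mem[of t] d(2)[of t] that by auto
  then show ?thesis using d(1) by (intro exI[of _ "min d 1"]) simp
qed

lemma numerical_range_halfplane:
  assumes "c \<in> closure ((\<lambda>x. cinner (A x) x) ` {x\<in>N. norm x = 1})"
    and "\<And>x. x \<in> N \<Longrightarrow> norm x = 1 \<Longrightarrow> Re (u * cinner (A x) x) \<le> k"
  shows "Re (u * c) \<le> k"
proof -
  have "closed {d. Re (u * d) \<le> k}" by (intro closed_Collect_le continuous_intros)
  then have "closure ((\<lambda>x. cinner (A x) x) ` {x\<in>N. norm x = 1}) \<subseteq> {d. Re (u * d) \<le> k}"
    using assms(2) by (intro closure_minimal) auto
  then show ?thesis using assms(1) by blast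
qed

text \<open>The supremum of \<open>\<bar>\<langle>A x, x\<rangle>\<bar>\<close> over the unit sphere of \<open>N\<close> is a maximum only on the closure of the numerical
  range. It is not \<open>0\<close>, since otherwise the quadratic forms of both real parts of \<open>A\<close> would vanish on \<open>N\<close>,
  and with them \<open>A\<close>.\<close>

lemma exists_extreme_numerical_value:
  assumes A: "bounded_clinear A" and N: "reducing A N" and y: "y \<in> N" "A y \<noteq> 0"
  shows "\<exists>c. c \<in> closure ((\<lambda>x. cinner (A x) x) ` {x\<in>N. norm x = 1}) \<and> c \<noteq> 0 \<and>
    (\<forall>x\<in>N. cmod (cinner (A x) x) \<le> cmod c * (norm x)\<^sup>2)"
proof -
  define W where "W = (\<lambda>x. cinner (A x) x) ` {x\<in>N. norm x = 1}"
  have N': "closed_csubspace N" using N by (simp add: reducing_def)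
  have "y \<noteq> 0" using y(2) bounded_clinear_scaleR[OF A, of 0 y] by auto
  have normalize: "inverse (norm x) *\<^sub>R x \<in> {x\<in>N. norm x = 1}" if "x \<in> N" "x \<noteq> 0" for x
    using that closed_csubspaceD(5)[OF N'] by simp
  obtain K where K: "\<And>x. norm (A x) \<le> norm x * K"
    using bounded_linear.bounded[OF bounded_clinear_imp_bounded_linear[OF A]] by blast
  have "cmod (cinner (A x) x) \<le> K" if "norm x = 1" for x
    using cinner_Cauchy_Schwarz[of "A x" x] K[of x] that by simp
  then have "bounded W" unfolding W_def by (intro boundedI[of _ K]) auto
  then have "compact (closure W)" by (simp add: compact_closure)
  moreover have "closure W \<noteq> {}" unfolding W_def using normalize[OF y(1) \<open>y \<noteq> 0\<close>] by auto
  ultimately obtain c where c: "c \<in> closure W" "\<And>d. d \<in> closure W \<Longrightarrow> cmod d \<le> cmod c"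
    using continuous_attains_sup[of "closure W" cmod] continuous_on_norm_id by blast
  have le: "cmod (cinner (A x) x) \<le> cmod c * (norm x)\<^sup>2" if "x \<in> N" for x
  proof (cases "x = 0")
    case False
    define v where "v = inverse (norm x) *\<^sub>R x"
    have "cinner (A v) v \<in> closure W"
      using normalize[OF that False] closure_subset[of W] by (auto simp: W_def v_def)
    then have "cmod (cinner (A v) v) \<le> cmod c" by (rule c(2))
    moreover have "cinner (A v) v = cinner (A x) x / of_real ((norm x)\<^sup>2)"
      by (simp add: v_def bounded_clinear_scaleR[OF A] cinner_simps field_simps power2_eq_square)
    ultimately show ?thesis using False by (simp add: norm_divide norm_power field_simps)
  qed simp
  have "c \<noteq> 0"
  proof
    assume "c = 0"
    then have zero: "Re (cinner (herm_part A u x) x) = 0" if "x \<in> N" for u x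
      using le[OF that] by (simp add: Re_cinner_herm_part[OF A])
    have "herm_part A u y = 0" for u
      by (rule kernel_if_positive_form_zero[OF bounded_clinear_herm_part[OF A]
            selfadjoint_herm_part[OF A] N' herm_part_in_reducing[OF N] _ y(1)])
        (simp_all add: zero y(1))
    then show False using herm_parts_vanish_imp_zero y(2) by blast
  qed
  then show ?thesis using c(1) le unfolding W_def by blast
qed

text \<open>Let \<open>r\<close> be the numerical radius of \<open>A\<close> on \<open>N\<close>, and let \<open>w\<close> rotate an extreme value \<open>c\<close> of the closed
  numerical range to \<open>r\<close>. Write \<open>w A + cnj w A\<^sup>* = H\<close> and \<open>\<i> w A + cnj (\<i> w) A\<^sup>* = K\<close>. The top eigenvalue
  \<open>s t\<close> of \<open>H + t K\<close> on \<open>N\<close> is at least \<open>2 r\<close>, as \<open>c\<close> shows, and at most \<open>2 r sqrt (1 + t\<^sup>2)\<close>. An eigenvector for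
  it puts the point \<open>- (u t, cnj (u t)) / s t\<close> into the joint point spectrum, and a line through this point
  makes \<open>s t\<close> an affine function of \<open>t\<close>. Only finitely many lines come into question, so \<open>s t = 2 r\<close> for all
  small \<open>t\<close>. Then \<open>2 r - H - t K\<close> is positive on \<open>N\<close> for small \<open>t\<close> of both signs. A unit vector \<open>x\<close> with
  \<open>H x = 2 r x\<close> has \<open>\<langle>K x, x\<rangle> = 0\<close> for this reason, the positive form vanishes at \<open>x\<close>, and \<open>K x = 0\<close>.\<close>

lemma joint_eigenvector_if_spectrum_in_lines:
  fixes A :: "'a::chilbert_space \<Rightarrow> 'a"
  assumes cpt: "compact_operator A" and N: "reducing A N" and y: "y \<in> N" "A y \<noteq> 0"
    and lines: "\<And>R. \<exists>F. finite F \<and> (\<forall>z\<in>joint_point_spectrum A (cadjoint A).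
      norm z \<le> R \<longrightarrow> (\<exists>(l, m)\<in>F. z \<in> dual_line l m))"
  shows "\<exists>x\<in>N. \<exists>l. joint_eigenvector A l x"
proof -
  note A = compact_operator_imp_bounded_clinear[OF cpt]
  have N': "closed_csubspace N" using N by (simp add: reducing_def)
  obtain c where c: "c \<in> closure ((\<lambda>x. cinner (A x) x) ` {x\<in>N. norm x = 1})" "c \<noteq> 0"
    and max: "\<And>x. x \<in> N \<Longrightarrow> cmod (cinner (A x) x) \<le> cmod c * (norm x)\<^sup>2"
    using exists_extreme_numerical_value[OF A N y] by blast
  define r where "r = cmod c"
  define w where "w = cnj c / r"
  define u where "u t = w * Complex 1 t" for t
  have r: "r > 0" using c(2) by (simp add: r_def)
  have w: "cmod w = 1" using r by (simp add: w_def r_def norm_divide)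
  have wc: "w * c = r"
    using r complex_norm_square[of c]
    by (simp add: w_def r_def power2_eq_square field_simps)
  have cu: "cmod (u t) = sqrt (1 + t\<^sup>2)" for t
    by (simp add: u_def norm_mult w complex_norm)
  have ex: "\<exists>s>0. (\<exists>x\<in>N. norm x = 1 \<and> herm_part A (u t) x = s *\<^sub>R x) \<and>
    (\<forall>x\<in>N. Re (cinner (herm_part A (u t) x) x) \<le> s * (norm x)\<^sup>2)" for t
  proof -
    have "u t * c = r * Complex 1 t" by (simp add: u_def wc[symmetric] ac_simps)
    then have "\<not> Re (u t * c) \<le> 0" using r by simp
    then obtain x where "x \<in> N" "Re (u t * cinner (A x) x) > 0"
      using numerical_range_halfplane[OF c(1), of "u t" 0] by force
    then show ?thesis
      by (intro top_eigenvector[OF bounded_clinear_herm_part[OF A] seq_compact_map_herm_part[OF cpt]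
            selfadjoint_herm_part[OF A] N' herm_part_in_reducing[OF N]])
        (auto simp: Re_cinner_herm_part[OF A])
  qed
  define P where "P t s \<longleftrightarrow> s > 0 \<and>
    (\<exists>x\<in>N. norm x = 1 \<and> herm_part A (u t) x = s *\<^sub>R x) \<and>
    (\<forall>x\<in>N. Re (cinner (herm_part A (u t) x) x) \<le> s * (norm x)\<^sup>2)" for t s
  have "\<forall>t. \<exists>s. P t s" using ex unfolding P_def by simp
  then obtain s where "\<And>t. P t (s t)" by metis
  then have s: "\<And>t. s t > 0"
    and eig: "\<And>t. \<exists>x\<in>N. norm x = 1 \<and> herm_part A (u t) x = s t *\<^sub>R x"
    and top: "\<And>t x. x \<in> N \<Longrightarrow> Re (cinner (herm_part A (u t) x) x) \<le> s t * (norm x)\<^sup>2"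
    unfolding P_def by simp_all
  have lower: "2 * r \<le> s t" for t
  proof -
    have "Re (u t * c) \<le> s t / 2"
    proof (rule numerical_range_halfplane[OF c(1)])
      fix x assume "x \<in> N" "norm x = 1"
      then show "Re (u t * cinner (A x) x) \<le> s t / 2"
        using top[of x t] by (simp add: Re_cinner_herm_part[OF A])
    qed
    moreover have "u t * c = r * Complex 1 t" by (simp add: u_def wc[symmetric] ac_simps)
    ultimately show ?thesis by simp
  qed
  have upper: "s t \<le> 2 * r + r * t\<^sup>2" for t
  proof -
    obtain x where x: "x \<in> N" "norm x = 1" "herm_part A (u t) x = s t *\<^sub>R x" using eig by blast
    have "s t = Re (cinner (herm_part A (u t) x) x)"
      by (simp add: x cinner_simps cinner_self)
    also have "\<dots> \<le> 2 * (cmod (u t) * cmod (cinner (A x) x))"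
      unfolding Re_cinner_herm_part[OF A] using complex_Re_le_cmod[of "u t * cinner (A x) x"]
      by (simp add: norm_mult)
    also have "\<dots> \<le> 2 * (sqrt (1 + t\<^sup>2) * r)"
      using max[OF x(1)] x(2) by (simp add: cu r_def mult_left_mono)
    also have "\<dots> \<le> 2 * ((1 + t\<^sup>2 / 2) * r)"
    proof -
      have "1 + t\<^sup>2 \<le> (1 + t\<^sup>2 / 2)\<^sup>2" by (simp add: power2_sum power_divide)
      then have "sqrt (1 + t\<^sup>2) \<le> 1 + t\<^sup>2 / 2" by (intro real_le_lsqrt) auto
      then show ?thesis using r by simp
    qed
    finally show ?thesis by (simp add: algebra_simps)
  qed
  obtain F where F: "finite F" "\<And>z. z \<in> joint_point_spectrum A (cadjoint A) \<Longrightarrow> norm z \<le> 2 / r \<Longrightarrow>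
      \<exists>(l, m)\<in>F. z \<in> dual_line l m"
    using lines[of "2 / r"] by blast
  \<comment> \<open>On the line with coefficients \<open>l, m\<close> the eigenvalue is \<open>l u t + m cnj (u t)\<close>, here as intercept and
    slope in \<open>t\<close>. For \<open>\<bar>t\<bar> \<le> 1\<close> the spectral point has norm at most \<open>2 / r\<close>, which gives the radius for \<open>F\<close>.\<close>
  define G where "G = (\<lambda>(l, m). (Re (l * w + m * cnj w), - Im (l * w - m * cnj w))) ` F"
  have branch: "\<exists>(p, q)\<in>G. s t = p + t * q" if "\<bar>t\<bar> \<le> 1" for t
  proof -
    obtain x where x: "x \<in> N" "norm x = 1" "herm_part A (u t) x = s t *\<^sub>R x" using eig by blast
    define z :: "complex ^ 2" where "z = vector [- u t / s t, - cnj (u t) / s t]"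
    have "x + z $ 1 *\<^sub>C A x + z $ 2 *\<^sub>C cadjoint A x
        = x + (- 1 / complex_of_real (s t)) *\<^sub>C herm_part A (u t) x"
      by (simp add: z_def herm_part_def scaleC_simps)
    also have "\<dots> = 0"
      using s[of t] unfolding x(3) scaleC_of_real[symmetric]
      by (simp add: scaleC_scaleC scaleC_minus_left)
    finally have "z \<in> joint_point_spectrum A (cadjoint A)"
      unfolding joint_point_spectrum_iff[OF A] using x(2) by (intro exI[of _ x]) auto
    moreover have "norm z \<le> 2 / r"
    proof -
      have "t\<^sup>2 \<le> 1" using that by (simp add: abs_square_le_1)
      then have "cmod (u t) \<le> 2" unfolding cu by (intro real_le_lsqrt) auto
      then have "cmod (u t) / s t \<le> 2 / (2 * r)"
        using lower[of t] r by (intro frac_le) auto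
      then show ?thesis using norm_vec2_le[of z] s[of t] by (simp add: z_def norm_divide)
    qed
    ultimately obtain l m where lm: "(l, m) \<in> F" "z \<in> dual_line l m" using F(2) by blast
    then have "l * u t + m * cnj (u t) = s t"
      using s[of t] by (simp add: dual_line_def z_def field_simps)
    then have "s t = Re (l * u t + m * cnj (u t))" by simp
    also have "\<dots> = Re (l * w + m * cnj w) + t * - Im (l * w - m * cnj w)"
      by (simp add: u_def algebra_simps)
    finally show ?thesis using lm(1) unfolding G_def by fast
  qed
  have "finite G" using F(1) by (simp add: G_def)
  from constant_near_0_if_finitely_many_lines[OF this branch lower upper]
  obtain d where d: "d > 0" "\<And>t. \<bar>t\<bar> < d \<Longrightarrow> s t = 2 * r" by blast
  define t where "t = d / 2"
  have t: "t > 0" "s 0 = 2 * r" "s t = 2 * r" "s (- t) = 2 * r"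
    using d by (auto simp: t_def)
  have u0: "u 0 = w" by (simp add: u_def complex_eq_iff)
  obtain x where x: "x \<in> N" "norm x = 1" "herm_part A w x = (2 * r) *\<^sub>R x"
    using eig[of 0] t(2) u0 by auto
  define g where "g = w * cinner (A x) x"
  have "Re (cinner (herm_part A w x) x) = 2 * r" by (simp add: x cinner_simps cinner_self)
  then have "Re g = r" by (simp add: Re_cinner_herm_part[OF A] g_def)
  have form: "Re (cinner (herm_part A (u \<tau>) x) x) = 2 * r - 2 * \<tau> * Im g" for \<tau>
  proof -
    have "u \<tau> * cinner (A x) x = g * Complex 1 \<tau>" by (simp add: u_def g_def ac_simps)
    then show ?thesis by (simp add: Re_cinner_herm_part[OF A] \<open>Re g = r\<close> algebra_simps)
  qed
  \<comment> \<open>The form of \<open>H + \<tau> K\<close> at \<open>x\<close> is affine in \<open>\<tau>\<close> and stays below its value at \<open>0\<close> for \<open>\<tau> = t\<close> and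
    for \<open>\<tau> = - t\<close>.\<close>
  have "t * Im g = 0"
    using top[OF x(1), of t] top[OF x(1), of "- t"] x(2) t(3,4) by (simp add: form)
  define E where "E = (\<lambda>v. (2 * r) *\<^sub>R v - herm_part A (u t) v)"
  have "E x = 0"
  proof (rule kernel_if_positive_form_zero[OF _ _ N' _ _ x(1)])
    show "bounded_clinear E" "selfadjoint E"
      unfolding E_def
      by (intro bounded_clinear_scaleR_minus bounded_clinear_herm_part A
          selfadjoint_scaleR_minus selfadjoint_herm_part)+
    show "E v \<in> N" if "v \<in> N" for v
      unfolding E_def using that
      by (intro closed_csubspaceD(5,6)[OF N'] herm_part_in_reducing[OF N])
    show "0 \<le> Re (cinner (E v) v)" if "v \<in> N" for v
      using top[OF that, of t] t(3) by (simp add: E_def cinner_simps norm_sq_eq_Re_cinner)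
    show "Re (cinner (E x) x) = 0"
      using \<open>t * Im g = 0\<close> form[of t] by (simp add: E_def cinner_simps cinner_self x(2))
  qed
  moreover have "herm_part A (u t) x = herm_part A w x + t *\<^sub>R herm_part A (\<i> * w) x"
  proof -
    have "u t = w + of_real t * (\<i> * w)" by (simp add: u_def complex_eq_iff)
    then show ?thesis
      by (simp add: herm_part_def scaleC_of_real[symmetric] scaleC_simps)
  qed
  ultimately have "herm_part A (\<i> * w) x = 0 *\<^sub>R x"
    using t(1) x(3) by (simp add: E_def)
  from joint_eigenvector_if_herm_part_eigenvector[OF _ w x(3) this] x show ?thesis by force
qed

section \<open>The characterization\<close>

lemma reducing_orthogonal_complement_of_joint_eigenvectors:
  fixes A :: "'a::chilbert_space \<Rightarrow> 'a"
  assumes A: "bounded_clinear A"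
  shows "reducing A {x. \<forall>l e. joint_eigenvector A l e \<longrightarrow> cinner x e = 0}"
    (is "reducing A ?N")
proof -
  have "closed {x::'a. cinner x e = 0}" for e
    by (intro closed_Collect_eq linear_continuous_on continuous_on_const
        bounded_bilinear.bounded_linear_left[OF bounded_bilinear_cinner])
  then have "closed (\<Inter>e\<in>{e. \<exists>l. joint_eigenvector A l e}. {x. cinner x e = 0})"
    by (intro closed_INT ballI)
  moreover have "?N = (\<Inter>e\<in>{e. \<exists>l. joint_eigenvector A l e}. {x. cinner x e = 0})" by blast
  ultimately have "closed ?N" by simp
  moreover have "A x \<in> ?N" "cadjoint A x \<in> ?N" if "x \<in> ?N" for x
    using that
    by (auto simp: cinner_cadjoint_right[OF A] cinner_cadjoint_left[OF A] joint_eigenvector_def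
        cinner_simps)
  ultimately show ?thesis
    by (auto simp: reducing_def closed_csubspace_def cinner_simps)
qed

text \<open>The self-commutator \<open>C\<close> kills every joint eigenvector, so being self-adjoint it maps into their
  orthogonal complement. There \<open>A\<close> and \<open>A\<^sup>*\<close> vanish, so \<open>C\<^sup>2 = 0\<close> and therefore \<open>C = 0\<close>. This replaces an
  expansion in eigenvectors.\<close>

lemma normal_if_zero_on_complement:
  fixes A :: "'a::chilbert_space \<Rightarrow> 'a"
  assumes A: "bounded_clinear A"
    and zero: "\<And>x. (\<And>l e. joint_eigenvector A l e \<Longrightarrow> cinner x e = 0) \<Longrightarrow> A x = 0"
  shows "normal_operator A"
proof -
  note A' = bounded_clinear_cadjoint[OF A]
  define N where "N = {x. \<forall>l e. joint_eigenvector A l e \<longrightarrow> cinner x e = 0}"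
  have N: "reducing A N"
    unfolding N_def by (rule reducing_orthogonal_complement_of_joint_eigenvectors[OF A])
  have A0: "A x = 0" if "x \<in> N" for x using zero that by (simp add: N_def)
  have A'0: "cadjoint A x = 0" if "x \<in> N" for x
  proof -
    have "A (cadjoint A x) = 0" using A0 N that by (simp add: reducing_def)
    then have "(norm (cadjoint A x))\<^sup>2 = 0"
      by (simp add: norm_sq_eq_Re_cinner cinner_cadjoint_right[OF A, symmetric])
    then show ?thesis by simp
  qed
  define C where "C x = A (cadjoint A x) - cadjoint A (A x)" for x
  have sa: "cinner (C x) v = cinner x (C v)" for x v
    by (simp add: C_def cinner_simps cinner_cadjoint_right[OF A] cinner_cadjoint_left[OF A])
  have "C x = 0" for x
  proof -
    have "cinner (C x) e = 0" if "joint_eigenvector A l e" for l e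
    proof -
      have "C e = 0"
        using that by (simp add: C_def joint_eigenvector_def bounded_clinear_scaleC[OF A]
            bounded_clinear_scaleC[OF A'] scaleC_scaleC mult.commute)
      then show ?thesis by (simp add: sa)
    qed
    then have "C x \<in> N" by (simp add: N_def)
    then have "C (C x) = A 0 - cadjoint A 0" by (simp add: C_def[of "C x"] A0 A'0)
    also have "\<dots> = 0"
      using bounded_clinear_scaleR[OF A, of 0 0] bounded_clinear_scaleR[OF A', of 0 0] by simp
    finally have "cinner (C x) (C x) = 0" by (simp add: sa)
    then show ?thesis by (simp add: cinner_self_eq_0_iff)
  qed
  then show ?thesis by (simp add: normal_operator_def C_def fun_eq_iff)
qed

text \<open>No line of the family contains the origin, because \<open>I\<close> is injective; and a bounded region meets only
  finitely many of them.\<close>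

lemma bounded_spectrum_in_finitely_many_lines:
  assumes A: "bounded_clinear A"
    and L: "\<forall>L\<in>\<L>. complex_line L" "locally_finite_in euclidean \<L>"
    and eq: "joint_point_spectrum A (cadjoint A) = \<Union>\<L>"
  shows "\<exists>F. finite F \<and> (\<forall>z\<in>joint_point_spectrum A (cadjoint A).
    norm z \<le> R \<longrightarrow> (\<exists>(l, m)\<in>F. z \<in> dual_line l m))"
proof -
  have "0 \<notin> joint_point_spectrum A (cadjoint A)" by (simp add: joint_point_spectrum_iff[OF A])
  then have "\<forall>L\<in>\<L>. \<exists>a. L \<subseteq> dual_line (fst a) (snd a)"
    using L(1) eq complex_line_subset_dual_line by (metis UnionI fst_conv snd_conv)
  then obtain h where h: "\<And>L. L \<in> \<L> \<Longrightarrow> L \<subseteq> dual_line (fst (h L)) (snd (h L))" by metis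
  define \<M> where "\<M> = {L\<in>\<L>. L \<inter> cball 0 R \<noteq> {}}"
  have "finite \<M>"
    unfolding \<M>_def using finite_meeting_compact_if_locally_finite[OF L(2)] by simp
  moreover have "\<exists>(l, m)\<in>h ` \<M>. z \<in> dual_line l m"
    if z: "z \<in> joint_point_spectrum A (cadjoint A)" "norm z \<le> R" for z
  proof -
    obtain L where "L \<in> \<L>" "z \<in> L" using z(1) eq by blast
    moreover from this have "L \<in> \<M>" using z(2) unfolding \<M>_def by auto
    ultimately show ?thesis using h by (intro bexI[of _ "h L"]) (auto simp: case_prod_beta)
  qed
  ultimately show ?thesis by (intro exI[of _ "h ` \<M>"]) blast
qed

theorem corollaryC:
  fixes A :: "'a::chilbert_space \<Rightarrow> 'a"
  assumes "compact_operator A" and "A \<noteq> (\<lambda>x. 0)"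
  shows "normal_operator A \<longleftrightarrow>
    (\<exists>\<L>. countable \<L> \<and> (\<forall>L\<in>\<L>. complex_line L) \<and> locally_finite_in euclidean \<L> \<and>
      joint_point_spectrum A (cadjoint A) = \<Union>\<L>)"
proof
  note A = compact_operator_imp_bounded_clinear[OF assms(1)]
  show "\<exists>\<L>. countable \<L> \<and> (\<forall>L\<in>\<L>. complex_line L) \<and> locally_finite_in euclidean \<L> \<and>
      joint_point_spectrum A (cadjoint A) = \<Union>\<L>" if norm: "normal_operator A"
  proof -
    define S where "S = {l. l \<noteq> 0 \<and> (\<exists>x. joint_eigenvector A l x)}"
    have fin: "finite {l\<in>S. cmod l \<ge> e}" if "e > 0" for e
      by (rule finite_subset[OF _ finite_large_joint_eigenvalues[OF assms(1) that]])
        (auto simp: S_def)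
    have "countable S" by (rule countable_if_finite_large[OF fin]) (simp_all add: S_def)
    moreover have "\<forall>L\<in>(\<lambda>l. dual_line l (cnj l)) ` S. complex_line L"
      by (auto simp: S_def intro: complex_line_dual_line)
    ultimately show ?thesis
      using joint_point_spectrum_normal[OF assms(1) norm] locally_finite_dual_lines[OF fin]
      by (intro exI[of _ "(\<lambda>l. dual_line l (cnj l)) ` S"]) (simp add: S_def)
  qed
  assume "\<exists>\<L>. countable \<L> \<and> (\<forall>L\<in>\<L>. complex_line L) \<and> locally_finite_in euclidean \<L> \<and>
      joint_point_spectrum A (cadjoint A) = \<Union>\<L>"
  then obtain \<L> where L: "\<forall>L\<in>\<L>. complex_line L" "locally_finite_in euclidean \<L>"
    "joint_point_spectrum A (cadjoint A) = \<Union>\<L>" by blast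
  show "normal_operator A"
  proof (rule normal_if_zero_on_complement[OF A], rule ccontr)
    fix y
    assume orth: "\<And>l e. joint_eigenvector A l e \<Longrightarrow> cinner y e = 0" and "A y \<noteq> 0"
    define N where "N = {x. \<forall>l e. joint_eigenvector A l e \<longrightarrow> cinner x e = 0}"
    have "y \<in> N" using orth by (simp add: N_def)
    have N: "reducing A N"
      unfolding N_def by (rule reducing_orthogonal_complement_of_joint_eigenvectors[OF A])
    obtain x l where "x \<in> N" "joint_eigenvector A l x"
      using joint_eigenvector_if_spectrum_in_lines[OF assms(1) N \<open>y \<in> N\<close> \<open>A y \<noteq> 0\<close>
          bounded_spectrum_in_finitely_many_lines[OF A L]] by blast
    then have "cinner x x = 0" "x \<noteq> 0" by (auto simp: N_def joint_eigenvector_def)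
    then show False by (simp add: cinner_self_eq_0_iff)
  qed
qed

end
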